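(* For every integer $n \geq 1$, $\mathrm{C}_{\sharp = n} <_W \mathrm{C}_{\sharp = n+1}$, i.e. $\mathrm{C}_{\sharp = n} \leq_W \mathrm{C}_{\sharp = n+1}$ but $\mathrm{C}_{\sharp = n+1} \nleq_W \mathrm{C}_{\sharp = n}$.
   Context: A represented space is a set $X$ with a partial surjection $\delta_X :\subseteq \mathbb{N}^\mathbb{N} \to X$. A realizer of a multivalued $f :\subseteq X \rightrightarrows Y$ is a partial $F$ on Baire space with $\delta_Y F(p) \in f(\delta_X(p))$ for all $p \in \operatorname{dom}(f\delta_X)$. $f \leq_W g$ iff there are computable partial $K,H$ on Baire space such that $p \mapsto K\langle p, G(H(p))\rangle$ realizes $f$ for every realizer $G$ of $g$. Closed choice $\mathrm{C}_X$ on a space $X$ takes a non-empty closed set (given negatively) and returns any point of it. Closed subsets of Cantor space are named by binary trees (the set of infinite paths); $\mathrm{C}_{\sharp = m}$ is the restriction of $\mathrm{C}_{\{0,1\}^\mathbb{N}}$ to those trees which have exactly $m$ vertices at every level $k$ with $2^k \geq m$ and in which from some finite depth onwards every vertex has exactly one child (so the set has exactly $m$ points). *)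

theory Defs
  imports Main "HOL-Library.Nat_Bijection"
begin

datatype recf = Z | S | Proj nat | Comp recf "recf list" | Prim recf recf | Mn recf

inductive eval_rec :: "recf \<Rightarrow> nat list \<Rightarrow> nat \<Rightarrow> bool" where
  ev_Z: "eval_rec Z xs 0"
| ev_S: "eval_rec S (x # xs) (Suc x)"
| ev_Proj: "i < length xs \<Longrightarrow> eval_rec (Proj i) xs (xs ! i)"
| ev_Comp: "length ys = length gs \<Longrightarrow> (\<forall>i<length gs. eval_rec (gs ! i) xs (ys ! i))
             \<Longrightarrow> eval_rec f ys z \<Longrightarrow> eval_rec (Comp f gs) xs z"
| ev_Prim0: "eval_rec f xs y \<Longrightarrow> eval_rec (Prim f g) (0 # xs) y"
| ev_PrimS: "eval_rec (Prim f g) (n # xs) y \<Longrightarrow> eval_rec g (y # n # xs) z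
             \<Longrightarrow> eval_rec (Prim f g) (Suc n # xs) z"
| ev_Mn: "eval_rec f (n # xs) 0 \<Longrightarrow> (\<forall>m<n. \<exists>y. eval_rec f (m # xs) (Suc y))
             \<Longrightarrow> eval_rec (Mn f) xs n"

type_synonym baire = "nat \<Rightarrow> nat"

definition prefix_code :: "baire \<Rightarrow> nat \<Rightarrow> nat" where
  "prefix_code p k = list_encode (map p [0..<k])"

text \<open>A partial function F on Baire space is computable if some partial recursive c,
  given n and (a code of) a finite prefix of the input p, either diverges or outputs the
  n-th symbol of F(p), and does output it for some sufficiently long prefix.
  Only the behaviour on dom(F) is constrained (type-2 computability restricted to dom F).\<close>
definition computable :: "(baire \<Rightarrow> baire option) \<Rightarrow> bool" where
  "computable F \<longleftrightarrow> (\<exists>c. \<forall>p q. F p = Some q \<longrightarrow>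
      (\<forall>n k y. eval_rec c [n, prefix_code p k] y \<longrightarrow> y = q n) \<and>
      (\<forall>n. \<exists>k. eval_rec c [n, prefix_code p k] (q n)))"

definition pairing :: "baire \<Rightarrow> baire \<Rightarrow> baire" where
  "pairing p q = (\<lambda>n. if even n then p (n div 2) else q (n div 2))"

text \<open>Represented spaces: partial maps delta :: baire \<Rightarrow> 'x option.
  A multivalued partial function f is 'x \<Rightarrow> 'y set, with dom f = {x. f x \<noteq> {}}.\<close>
definition realizes ::
  "(baire \<Rightarrow> 'x option) \<Rightarrow> (baire \<Rightarrow> 'y option) \<Rightarrow> ('x \<Rightarrow> 'y set) \<Rightarrow> (baire \<Rightarrow> baire option) \<Rightarrow> bool"
  where
  "realizes dX dY f F \<longleftrightarrow> (\<forall>p x. dX p = Some x \<and> f x \<noteq> {} \<longrightarrow>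
      (\<exists>q y. F p = Some q \<and> dY q = Some y \<and> y \<in> f x))"

definition weihrauch_le ::
  "(baire \<Rightarrow> 'x1 option) \<Rightarrow> (baire \<Rightarrow> 'y1 option) \<Rightarrow> ('x1 \<Rightarrow> 'y1 set) \<Rightarrow>
   (baire \<Rightarrow> 'x2 option) \<Rightarrow> (baire \<Rightarrow> 'y2 option) \<Rightarrow> ('x2 \<Rightarrow> 'y2 set) \<Rightarrow> bool"
  where
  "weihrauch_le dX1 dY1 f dX2 dY2 g \<longleftrightarrow> (\<exists>K H. computable K \<and> computable H \<and>
     (\<forall>G. realizes dX2 dY2 g G \<longrightarrow>
        realizes dX1 dY1 f (\<lambda>p. case H p of None \<Rightarrow> None
                                    | Some r \<Rightarrow> (case G r of None \<Rightarrow> None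
                                                 | Some s \<Rightarrow> K (pairing p s)))))"

definition is_tree :: "bool list set \<Rightarrow> bool" where
  "is_tree T \<longleftrightarrow> (\<forall>w v. w @ v \<in> T \<longrightarrow> w \<in> T)"

definition word_code :: "bool list \<Rightarrow> nat" where
  "word_code w = list_encode (map of_bool w)"

definition delta_tree :: "baire \<Rightarrow> bool list set option" where
  "delta_tree p = (let T = {w. p (word_code w) = 1} in
      if (\<forall>n. p n \<le> 1) \<and> is_tree T then Some T else None)"

definition delta_cantor :: "baire \<Rightarrow> (nat \<Rightarrow> bool) option" where
  "delta_cantor q = (if \<forall>n. q n \<le> 1 then Some (\<lambda>n. q n = 1) else None)"

definition paths :: "bool list set \<Rightarrow> (nat \<Rightarrow> bool) set" where
  "paths T = {x. \<forall>k. map x [0..<k] \<in> T}"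

definition card_m_tree :: "nat \<Rightarrow> bool list set \<Rightarrow> bool" where
  "card_m_tree m T \<longleftrightarrow> is_tree T \<and>
     (\<forall>k. 2 ^ k \<ge> m \<longrightarrow> card {w \<in> T. length w = k} = m) \<and>
     (\<exists>d. \<forall>w\<in>T. length w \<ge> d \<longrightarrow> card {b. w @ [b] \<in> T} = 1)"

definition C_card :: "nat \<Rightarrow> bool list set \<Rightarrow> (nat \<Rightarrow> bool) set" where
  "C_card m T = (if card_m_tree m T then paths T else {})"

end

(* Lower bound. Suppose that the choice of a path in trees with n + 1 paths reduces to the one for
   n paths. Feed the reduction a tree whose n + 1 paths are already separated at level L. The
   resulting tree has n paths, hence only n of the n + 1 vertices at level L are reached by the
   answers computed from them, and by continuity and finiteness this depends on a finite part of
   the input only. Beyond that part the input is still free to let all paths but the one through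
   a missed vertex die, one per level, and to let that path branch instead; the reduction then
   still answers with a path through a dead vertex.

   Upper bound. Add one more vertex to every level k >= L of the tree T, where 2 ^ L > n. Whenever
   a vertex w of T has a single child w b, the extra branch may be started at w (not b) and then
   copies the branch of T through w b as long as that branch does not split or die; otherwise it
   is restarted elsewhere as soon as possible. Since T eventually stops branching, so does the
   enlarged tree, and a path in it is turned into a path of T by flipping the bit with which it
   leaves T, if it does.

   Computability of both functionals is shown by closure properties of the functionals on Baire
   space that a partial recursive function computes from all sufficiently long prefixes. *)

theory Submission
  imports Defs "HOL.Filter"
begin

section \<open>Effective functionals\<close>

text \<open>The recursive function gets the approximation \<open>\<nu> p k\<close> of the oracle \<open>p\<close> as an additional
  last argument. The interesting case is \<open>\<nu> = prefix_code\<close>; a constant \<open>\<nu>\<close> yields ordinary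
  total recursive functions.\<close>

definition effective :: "('p \<Rightarrow> nat \<Rightarrow> nat) \<Rightarrow> nat \<Rightarrow> ('p \<Rightarrow> nat list \<Rightarrow> nat) \<Rightarrow> bool" where
  "effective \<nu> a f \<longleftrightarrow> (\<exists>c. \<forall>p xs. length xs = a \<longrightarrow>
     (\<forall>k y. eval_rec c (xs @ [\<nu> p k]) y \<longrightarrow> y = f p xs) \<and>
     (\<forall>\<^sub>F k in sequentially. eval_rec c (xs @ [\<nu> p k]) (f p xs)))"

lemma effectiveI:
  assumes "\<And>p xs k y. length xs = a \<Longrightarrow> eval_rec c (xs @ [\<nu> p k]) y \<Longrightarrow> y = f p xs"
    and "\<And>p xs. length xs = a \<Longrightarrow> \<forall>\<^sub>F k in sequentially. eval_rec c (xs @ [\<nu> p k]) (f p xs)"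
  shows "effective \<nu> a f"
  using assms unfolding effective_def by blast

lemma effective_cong:
  assumes "a = b" "\<And>p xs. length xs = b \<Longrightarrow> f p xs = g p xs"
  shows "effective \<nu> a f = effective \<nu> b g"
  using assms unfolding effective_def by auto

inductive_cases eval_ZE: "eval_rec Z xs y"
inductive_cases eval_SE: "eval_rec S xs y"
inductive_cases eval_ProjE: "eval_rec (Proj i) xs y"
inductive_cases eval_CompE: "eval_rec (Comp f gs) xs y"
inductive_cases eval_Prim_0E: "eval_rec (Prim f g) (0 # xs) y"
inductive_cases eval_Prim_SucE: "eval_rec (Prim f g) (Suc n # xs) y"
inductive_cases eval_MnE: "eval_rec (Mn f) xs y"

section \<open>Projections, composition and primitive recursion\<close>

lemma effective_nth:
  assumes "i < a" shows "effective \<nu> a (\<lambda>p xs. xs ! i)"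
proof (rule effectiveI[where c = "Proj i"])
  fix p and xs :: "nat list" and k y
  assume "length xs = a" "eval_rec (Proj i) (xs @ [\<nu> p k]) y"
  then show "y = xs ! i" using assms by (auto elim!: eval_ProjE simp: nth_append)
next
  fix p and xs :: "nat list"
  assume "length xs = a"
  then show "\<forall>\<^sub>F k in sequentially. eval_rec (Proj i) (xs @ [\<nu> p k]) (xs ! i)"
    using ev_Proj[of i "xs @ [\<nu> p _]"] assms by (auto simp: nth_append intro!: always_eventually)
qed

lemma effective_zero: "effective \<nu> a (\<lambda>p xs. 0)"
  by (rule effectiveI[where c = Z]) (auto elim: eval_ZE intro!: ev_Z always_eventually)

text \<open>Finitely many eventual conditions hold simultaneously; for this reason convergence is
  required for almost all approximations and not just for one.\<close>

lemma effective_comp: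
  assumes f: "effective \<nu> (length gs) f" and gs: "\<And>g. g \<in> set gs \<Longrightarrow> effective \<nu> a g"
  shows "effective \<nu> a (\<lambda>p xs. f p (map (\<lambda>g. g p xs) gs))"
proof -
  obtain c where c: "\<And>p xs k y. length xs = length gs \<Longrightarrow> eval_rec c (xs @ [\<nu> p k]) y \<Longrightarrow> y = f p xs"
    "\<And>p xs. length xs = length gs \<Longrightarrow> \<forall>\<^sub>F k in sequentially. eval_rec c (xs @ [\<nu> p k]) (f p xs)"
    using f unfolding effective_def by blast
  have "\<forall>i. \<exists>d. i < length gs \<longrightarrow> (\<forall>p xs. length xs = a \<longrightarrow>
     (\<forall>k y. eval_rec d (xs @ [\<nu> p k]) y \<longrightarrow> y = (gs ! i) p xs) \<and>
     (\<forall>\<^sub>F k in sequentially. eval_rec d (xs @ [\<nu> p k]) ((gs ! i) p xs)))" (is "\<forall>i. \<exists>d. ?Q i d")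
    using gs unfolding effective_def by (meson nth_mem)
  from choice[OF this] obtain d0 where "\<forall>i. ?Q i (d0 i)" ..
  then obtain d where d:
    "\<And>i p xs k y. i < length gs \<Longrightarrow> length xs = a \<Longrightarrow> eval_rec (d i) (xs @ [\<nu> p k]) y \<Longrightarrow> y = (gs ! i) p xs"
    "\<And>i p xs. i < length gs \<Longrightarrow> length xs = a \<Longrightarrow>
       \<forall>\<^sub>F k in sequentially. eval_rec (d i) (xs @ [\<nu> p k]) ((gs ! i) p xs)"
    by blast
  \<comment> \<open>The final projection hands the approximation of the oracle on to
    \<open>c\<close>.\<close>
  define ds where "ds = map d [0..<length gs] @ [Proj a]"
  have lds: "length ds = Suc (length gs)" by (simp add: ds_def)
  have ds_nth: "i < length gs \<Longrightarrow> ds ! i = d i" "ds ! length gs = Proj a" for i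
    by (simp_all add: ds_def nth_append)
  show ?thesis
  proof (rule effectiveI[where c = "Comp c ds"])
    fix p and xs :: "nat list" and k y
    assume xs: "length xs = a" and ev: "eval_rec (Comp c ds) (xs @ [\<nu> p k]) y"
    from ev obtain ys where ys: "length ys = length ds" "eval_rec c ys y"
      "\<forall>i<length ds. eval_rec (ds ! i) (xs @ [\<nu> p k]) (ys ! i)"
      by (auto elim: eval_CompE)
    have "ys ! i = (gs ! i) p xs" if "i < length gs" for i
      using d(1)[OF that xs, of p k "ys ! i"] ys(3)[rule_format, of i] that lds ds_nth(1)[OF that] by simp
    moreover have "ys ! length gs = \<nu> p k"
      using ys(3)[rule_format, of "length gs"] lds xs
      by (auto simp: ds_nth elim: eval_ProjE)
    ultimately have "ys = map (\<lambda>g. g p xs) gs @ [\<nu> p k]"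
      using ys(1) lds by (intro nth_equalityI) (auto simp: nth_append less_Suc_eq)
    with ys(2) c(1) show "y = f p (map (\<lambda>g. g p xs) gs)" by simp
  next
    fix p and xs :: "nat list"
    assume xs: "length xs = a"
    have "\<forall>\<^sub>F k in sequentially. \<forall>i\<in>{..<length gs}. eval_rec (d i) (xs @ [\<nu> p k]) ((gs ! i) p xs)"
      using d(2) xs by (intro eventually_ball_finite) auto
    moreover have "\<forall>\<^sub>F k in sequentially.
        eval_rec c (map (\<lambda>g. g p xs) gs @ [\<nu> p k]) (f p (map (\<lambda>g. g p xs) gs))"
      by (rule c(2)) simp
    ultimately show "\<forall>\<^sub>F k in sequentially.
        eval_rec (Comp c ds) (xs @ [\<nu> p k]) (f p (map (\<lambda>g. g p xs) gs))"
    proof eventually_elim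
      case (elim k)
      have "eval_rec (Proj a) (xs @ [\<nu> p k]) (\<nu> p k)"
        using ev_Proj[of a "xs @ [\<nu> p k]"] xs by (simp add: nth_append)
      then have "eval_rec (ds ! i) (xs @ [\<nu> p k]) ((map (\<lambda>g. g p xs) gs @ [\<nu> p k]) ! i)"
        if "i < length ds" for i
        using that lds elim(1) by (cases "i < length gs") (auto simp: ds_nth nth_append less_Suc_eq)
      with elim(2) lds show ?case by (intro ev_Comp) auto
    qed
  qed
qed

text \<open>With this rule and its binary version an operation need only be examined on bare
  variables; effective arguments are substituted afterwards.\<close>

lemma effective_comp1:
  assumes "effective \<nu> 1 (\<lambda>p xs. f p (xs ! 0))" "effective \<nu> a g"
  shows "effective \<nu> a (\<lambda>p xs. f p (g p xs))"
  using effective_comp[of \<nu> "[g]" "\<lambda>p xs. f p (xs ! 0)" a] assms by simp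

lemma effective_comp2:
  assumes "effective \<nu> 2 (\<lambda>p xs. f p (xs ! 0) (xs ! 1))" "effective \<nu> a g" "effective \<nu> a h"
  shows "effective \<nu> a (\<lambda>p xs. f p (g p xs) (h p xs))"
proof -
  have "effective \<nu> (length [g, h]) (\<lambda>p xs. f p (xs ! 0) (xs ! 1))"
    using assms(1) by (simp add: numeral_2_eq_2)
  from effective_comp[OF this, of a] assms(2,3) show ?thesis by fastforce
qed

text \<open>Variables bound by a sum, a search or a recursion are put in front of the parameters, so
  a function of the parameters has to be read on the tail of the list.\<close>

lemma effective_weaken:
  assumes "effective \<nu> a f" shows "effective \<nu> (Suc a) (\<lambda>p xs. f p (tl xs))"
proof -
  let ?gs = "map (\<lambda>i p xs. xs ! Suc i) [0..<a]"
  have "effective \<nu> (Suc a) (\<lambda>p xs. f p (map (\<lambda>g. g p xs) ?gs))"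
    using assms by (intro effective_comp) (auto intro!: effective_nth)
  moreover have "map (\<lambda>g. g p xs) ?gs = tl xs" if "length xs = Suc a" for p :: 'a and xs :: "nat list"
    using that by (intro nth_equalityI) (auto simp: nth_tl)
  ultimately show ?thesis by (subst effective_cong[OF refl, where g = "\<lambda>p xs. f p (map (\<lambda>g. g p xs) ?gs)"]) simp_all
qed

lemma effective_tl_nth: "Suc i < a \<Longrightarrow> effective \<nu> a (\<lambda>p xs. tl xs ! i)"
  by (cases a) (auto intro: effective_weaken effective_nth)

lemma effective_tl2_nth: "Suc (Suc i) < a \<Longrightarrow> effective \<nu> a (\<lambda>p xs. tl (tl xs) ! i)"
  by (cases a) (auto intro: effective_weaken[where f = "\<lambda>p xs. tl xs ! i"] effective_tl_nth)

text \<open>The list \<open>ys\<close> mirrors \<open>Prim\<close>: entry 0 is the previous value,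
  entry 1 the counter, and the parameters follow.\<close>

lemma effective_rec:
  assumes b: "effective \<nu> a b" and z: "effective \<nu> a z"
    and g: "effective \<nu> (Suc (Suc a)) (\<lambda>p ys. g p (tl (tl ys)) (ys ! 1) (ys ! 0))"
  shows "effective \<nu> a (\<lambda>p xs. rec_nat (z p xs) (\<lambda>i y. g p xs i y) (b p xs))"
proof -
  let ?r = "\<lambda>p xs. rec_nat (z p xs) (\<lambda>i y. g p xs i y)"
  obtain c where c: "\<And>p xs k y. length xs = a \<Longrightarrow> eval_rec c (xs @ [\<nu> p k]) y \<Longrightarrow> y = z p xs"
    "\<And>p xs. length xs = a \<Longrightarrow> \<forall>\<^sub>F k in sequentially. eval_rec c (xs @ [\<nu> p k]) (z p xs)"
    using z unfolding effective_def by blast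
  obtain d where d: "\<And>p xs i y k y'. length xs = a \<Longrightarrow> eval_rec d (y # i # xs @ [\<nu> p k]) y' \<Longrightarrow> y' = g p xs i y"
    "\<And>p xs i y. length xs = a \<Longrightarrow> \<forall>\<^sub>F k in sequentially. eval_rec d (y # i # xs @ [\<nu> p k]) (g p xs i y)"
  proof -
    obtain d where d: "\<And>p xs k y. length xs = Suc (Suc a) \<Longrightarrow> eval_rec d (xs @ [\<nu> p k]) y \<Longrightarrow>
         y = g p (tl (tl xs)) (xs ! 1) (xs ! 0)"
      "\<And>p xs. length xs = Suc (Suc a) \<Longrightarrow>
         \<forall>\<^sub>F k in sequentially. eval_rec d (xs @ [\<nu> p k]) (g p (tl (tl xs)) (xs ! 1) (xs ! 0))"
      using g unfolding effective_def by blast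
    show thesis
    proof (rule that)
      show "y' = g p xs i y" if "length xs = a" "eval_rec d (y # i # xs @ [\<nu> p k]) y'" for p xs i y k y'
        using d(1)[of "y # i # xs"] that by simp
      show "\<forall>\<^sub>F k in sequentially. eval_rec d (y # i # xs @ [\<nu> p k]) (g p xs i y)"
        if "length xs = a" for p xs i y
        using d(2)[of "y # i # xs"] that by simp
    qed
  qed
  \<comment> \<open>The recursion depth is first a separate leading argument, as in
    \<open>Prim\<close>; \<open>b\<close> is then substituted for it by composition.\<close>
  have "effective \<nu> (Suc a) (\<lambda>p xs. ?r p (tl xs) (xs ! 0))"
  proof (rule effectiveI[where c = "Prim c d"])
    fix p and xs :: "nat list" and k y
    assume xs: "length xs = Suc a" and ev: "eval_rec (Prim c d) (xs @ [\<nu> p k]) y"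
    then obtain n xs' where eq: "xs = n # xs'" "length xs' = a" by (cases xs) auto
    have "eval_rec (Prim c d) (n # xs' @ [\<nu> p k]) y \<Longrightarrow> y = ?r p xs' n" for y
    proof (induction n arbitrary: y)
      case 0
      then show ?case using c(1) eq(2) by (auto elim!: eval_Prim_0E)
    next
      case (Suc n)
      from Suc.prems obtain y' where "eval_rec (Prim c d) (n # xs' @ [\<nu> p k]) y'"
        "eval_rec d (y' # n # xs' @ [\<nu> p k]) y"
        by (auto elim: eval_Prim_SucE)
      then show ?case using Suc.IH d(1) eq(2) by auto
    qed
    with ev eq show "y = ?r p (tl xs) (xs ! 0)" by simp
  next
    fix p and xs :: "nat list"
    assume "length xs = Suc a"
    then obtain n xs' where eq: "xs = n # xs'" "length xs' = a" by (cases xs) auto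
    have "\<forall>\<^sub>F k in sequentially. eval_rec (Prim c d) (n # xs' @ [\<nu> p k]) (?r p xs' n)"
    proof (induction n)
      case 0
      show ?case using c(2)[OF eq(2), of p] by eventually_elim (auto intro: ev_Prim0)
    next
      case (Suc n)
      from Suc.IH d(2)[OF eq(2), of "?r p xs' n" n p] show ?case
        by eventually_elim (auto intro: ev_PrimS)
    qed
    with eq show "\<forall>\<^sub>F k in sequentially. eval_rec (Prim c d) (xs @ [\<nu> p k]) (?r p (tl xs) (xs ! 0))"
      by simp
  qed
  moreover let ?gs = "b # map (\<lambda>i p xs. xs ! i) [0..<a]"
  have "length ?gs = Suc a" by simp
  ultimately have "effective \<nu> (length ?gs) (\<lambda>p xs. ?r p (tl xs) (xs ! 0))" by metis
  then have "effective \<nu> a (\<lambda>p xs. (\<lambda>p xs. ?r p (tl xs) (xs ! 0)) p (map (\<lambda>g. g p xs) ?gs))"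
    by (rule effective_comp) (auto intro: b effective_nth)
  moreover have "map (\<lambda>g. g p xs) (map (\<lambda>i p xs. xs ! i) [0..<a]) = xs"
    if "length xs = a" for p :: 'a and xs :: "nat list"
    using that by (intro nth_equalityI) auto
  ultimately show ?thesis
    by (subst effective_cong[OF refl, where
          g = "\<lambda>p xs. (\<lambda>p xs. ?r p (tl xs) (xs ! 0)) p (map (\<lambda>g. g p xs) ?gs)"]) simp_all
qed

lemma effective_Suc:
  assumes "effective \<nu> a f" shows "effective \<nu> a (\<lambda>p xs. Suc (f p xs))"
proof -
  have "effective \<nu> 1 (\<lambda>p xs. Suc (xs ! 0))"
  proof (rule effectiveI[where c = S])
    fix p and xs :: "nat list"
    assume "length xs = 1"
    then obtain x where xs: "xs = [x]" by (auto simp: length_Suc_conv)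
    show "\<forall>\<^sub>F k in sequentially. eval_rec S (xs @ [\<nu> p k]) (Suc (xs ! 0))"
      using xs by (auto intro!: ev_S always_eventually)
    show "y = Suc (xs ! 0)" if "eval_rec S (xs @ [\<nu> p k]) y" for k y
      using that xs by (auto elim: eval_SE)
  qed
  from effective_comp1[where f = "\<lambda>p. Suc", OF this assms] show ?thesis .
qed

lemma effective_const: "effective \<nu> a (\<lambda>p xs. m)"
  by (induction m) (auto intro: effective_zero effective_Suc)

named_theorems effective_intros

lemmas [effective_intros] = effective_const effective_Suc effective_nth effective_tl_nth
  effective_tl2_nth effective_rec

section \<open>Arithmetic, decidable predicates and bounded quantifiers\<close>

lemma effective_add [effective_intros]:
  assumes "effective \<nu> a f" "effective \<nu> a g"
  shows "effective \<nu> a (\<lambda>p xs. f p xs + g p xs)"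
proof (rule effective_comp2[OF _ assms])
  have "effective \<nu> 2 (\<lambda>p xs. rec_nat (xs ! 0) (\<lambda>i y. Suc y) (xs ! 1))"
    by (intro effective_intros) auto
  moreover have "rec_nat m (\<lambda>i y. Suc y) n = m + n" for m n by (induction n) auto
  ultimately show "effective \<nu> 2 (\<lambda>p xs. xs ! 0 + xs ! 1)" by simp
qed

lemma effective_sum [effective_intros]:
  assumes "effective \<nu> a b" "effective \<nu> (Suc a) (\<lambda>p ys. f p (tl ys) (ys ! 0))"
  shows "effective \<nu> a (\<lambda>p xs. \<Sum>i<b p xs. f p xs i)"
proof -
  have "effective \<nu> (Suc (Suc a)) (\<lambda>p ys. f p (tl (tl ys)) (tl ys ! 0))"
    using effective_weaken[OF assms(2)] by simp
  moreover have "effective \<nu> (Suc (Suc a)) (\<lambda>p ys. f p (tl (tl ys)) (tl ys ! 0)) =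
      effective \<nu> (Suc (Suc a)) (\<lambda>p ys. f p (tl (tl ys)) (ys ! 1))"
    by (rule effective_cong) (auto simp: nth_tl)
  ultimately have "effective \<nu> a (\<lambda>p xs. rec_nat 0 (\<lambda>i y. y + f p xs i) (b p xs))"
    by (intro effective_intros assms(1)) auto
  moreover have "rec_nat 0 (\<lambda>i y. y + f p xs i) n = (\<Sum>i<n. f p xs i)" for p xs n
    by (induction n) auto
  ultimately show ?thesis by simp
qed

lemma effective_mult [effective_intros]:
  assumes "effective \<nu> a f" "effective \<nu> a g"
  shows "effective \<nu> a (\<lambda>p xs. f p xs * g p xs)"
proof (rule effective_comp2[OF _ assms])
  have "effective \<nu> 2 (\<lambda>p xs. \<Sum>i<xs ! 0. xs ! 1)" by (intro effective_intros) auto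
  then show "effective \<nu> 2 (\<lambda>p xs. xs ! 0 * xs ! 1)" by simp
qed

lemma effective_diff [effective_intros]:
  assumes "effective \<nu> a f" "effective \<nu> a g"
  shows "effective \<nu> a (\<lambda>p xs. f p xs - g p xs)"
proof (rule effective_comp2[OF _ assms])
  \<comment> \<open>A recursion that returns its counter is the predecessor function; iterating it
    gives truncated subtraction.\<close>
  have "effective \<nu> 1 (\<lambda>p xs. rec_nat 0 (\<lambda>i y. i) (xs ! 0))"
    by (intro effective_intros) auto
  from effective_comp1[OF this]
  have "effective \<nu> 2 (\<lambda>p xs. rec_nat (xs ! 0) (\<lambda>i y. rec_nat 0 (\<lambda>i y. i) y) (xs ! 1))"
    by (intro effective_intros) (auto intro: effective_nth)
  moreover have "rec_nat m (\<lambda>i y. rec_nat 0 (\<lambda>i y. i) y) n = m - n" for m n :: nat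
  proof (induction n)
    case (Suc n)
    have "rec_nat 0 (\<lambda>i y. i) k = k - 1" for k by (cases k) auto
    with Suc show ?case by simp
  qed simp
  ultimately show "effective \<nu> 2 (\<lambda>p xs. xs ! 0 - xs ! 1)" by simp
qed

text \<open>Predicates are handled through their 0/1 values; here truncated subtraction decides the
  comparison.\<close>

lemma effective_le [effective_intros]:
  assumes "effective \<nu> a f" "effective \<nu> a g"
  shows "effective \<nu> a (\<lambda>p xs. of_bool (f p xs \<le> g p xs))"
proof -
  have "effective \<nu> a (\<lambda>p xs. 1 - (f p xs - g p xs))"
    by (intro effective_intros assms)
  moreover have "(1 :: nat) - (m - n) = of_bool (m \<le> n)" for m n by simp
  ultimately show ?thesis by simp
qed

lemma effective_conj [effective_intros]:
  assumes "effective \<nu> a (\<lambda>p xs. of_bool (P p xs))" "effective \<nu> a (\<lambda>p xs. of_bool (Q p xs))"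
  shows "effective \<nu> a (\<lambda>p xs. of_bool (P p xs \<and> Q p xs))"
  using effective_mult[OF assms] by (simp add: of_bool_conj)

lemma effective_not [effective_intros]:
  assumes "effective \<nu> a (\<lambda>p xs. of_bool (P p xs))"
  shows "effective \<nu> a (\<lambda>p xs. of_bool (\<not> P p xs))"
proof -
  have "effective \<nu> a (\<lambda>p xs. 1 - of_bool (P p xs))" by (intro effective_intros assms)
  moreover have "1 - of_bool Q = (of_bool (\<not> Q) :: nat)" for Q by simp
  ultimately show ?thesis by simp
qed

lemma effective_disj [effective_intros]:
  assumes "effective \<nu> a (\<lambda>p xs. of_bool (P p xs))" "effective \<nu> a (\<lambda>p xs. of_bool (Q p xs))"
  shows "effective \<nu> a (\<lambda>p xs. of_bool (P p xs \<or> Q p xs))"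
proof -
  have "effective \<nu> a (\<lambda>p xs. of_bool (\<not> (\<not> P p xs \<and> \<not> Q p xs)))"
    by (intro effective_not effective_conj assms)
  then show ?thesis by simp
qed

lemma effective_less [effective_intros]:
  assumes "effective \<nu> a f" "effective \<nu> a g"
  shows "effective \<nu> a (\<lambda>p xs. of_bool (f p xs < g p xs))"
  using effective_le[OF effective_Suc[OF assms(1)] assms(2)] by (simp add: Suc_le_eq)

lemma effective_eq [effective_intros]:
  fixes f g :: "_ \<Rightarrow> _ \<Rightarrow> nat"
  assumes "effective \<nu> a f" "effective \<nu> a g"
  shows "effective \<nu> a (\<lambda>p xs. of_bool (f p xs = g p xs))"
proof -
  have "effective \<nu> a (\<lambda>p xs. of_bool (f p xs \<le> g p xs \<and> g p xs \<le> f p xs))"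
    by (intro effective_intros assms)
  then show ?thesis by (simp add: eq_iff)
qed

lemma effective_ex [effective_intros]:
  assumes "effective \<nu> a b" "effective \<nu> (Suc a) (\<lambda>p ys. of_bool (P p (tl ys) (ys ! 0)))"
  shows "effective \<nu> a (\<lambda>p xs. of_bool (\<exists>i<b p xs. P p xs i))"
proof -
  have "effective \<nu> a (\<lambda>p xs. of_bool (0 < (\<Sum>i<b p xs. of_bool (P p xs i) :: nat)))"
    by (intro effective_intros assms)
  moreover have "0 < (\<Sum>i<b p xs. of_bool (P p xs i) :: nat) \<longleftrightarrow> (\<exists>i<b p xs. P p xs i)" for p xs
    by (auto simp: sum_pos2 zero_less_iff_neq_zero)
  ultimately show ?thesis by simp
qed

lemma effective_if [effective_intros]:
  assumes "effective \<nu> a (\<lambda>p xs. of_bool (P p xs))" "effective \<nu> a f" "effective \<nu> a g"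
  shows "effective \<nu> a (\<lambda>p xs. if P p xs then f p xs else g p xs)"
proof -
  have "effective \<nu> a (\<lambda>p xs. of_bool (P p xs) * f p xs + (1 - of_bool (P p xs)) * g p xs)"
    by (intro effective_intros assms)
  then show ?thesis
    by (subst effective_cong[OF refl, where
       g = "\<lambda>p xs. of_bool (P p xs) * f p xs + (1 - of_bool (P p xs)) * g p xs"]) auto
qed

lemma effective_div [effective_intros]:
  assumes "effective \<nu> a f" "effective \<nu> a g"
  shows "effective \<nu> a (\<lambda>p xs. f p xs div g p xs)"
proof (rule effective_comp2[OF _ assms])
  \<comment> \<open>The quotient counts the positive multiples of the divisor up to the dividend;
    the guard \<open>0 < xs ! 1\<close> yields 0 for the divisor 0, as \<open>div\<close>
    does.\<close>
  have "effective \<nu> 2 (\<lambda>p xs. \<Sum>i<xs ! 0. of_bool (0 < xs ! 1 \<and> Suc i * xs ! 1 \<le> xs ! 0))"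
    by (intro effective_intros) auto
  moreover have "(\<Sum>i<m. of_bool (0 < n \<and> Suc i * n \<le> m)) = m div n" for m n :: nat
  proof (cases "n = 0")
    case False
    then have "{i. i < m \<and> 0 < n \<and> Suc i * n \<le> m} = {..<m div n}"
      using div_le_dividend[of m n]
      by (auto simp flip: less_eq_div_iff_mult_less_eq Suc_le_eq simp del: mult_Suc div_le_dividend)
    then show ?thesis by (simp add: of_bool_def sum.If_cases lessThan_def flip: Collect_conj_eq del: mult_Suc)
  qed simp
  ultimately show "effective \<nu> 2 (\<lambda>p xs. xs ! 0 div xs ! 1)" by simp
qed

lemma effective_mod [effective_intros]:
  assumes "effective \<nu> a f" "effective \<nu> a g"
  shows "effective \<nu> a (\<lambda>p xs. f p xs mod g p xs)"
proof -
  have "effective \<nu> a (\<lambda>p xs. f p xs - g p xs * (f p xs div g p xs))"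
    by (intro effective_intros assms)
  then show ?thesis by (simp add: minus_mult_div_eq_mod)
qed

lemma effective_power [effective_intros]:
  fixes m :: nat
  assumes "effective \<nu> a f"
  shows "effective \<nu> a (\<lambda>p xs. m ^ f p xs)"
proof -
  have "effective \<nu> a (\<lambda>p xs. rec_nat 1 (\<lambda>i y. m * y) (f p xs))"
    by (intro effective_intros assms) auto
  moreover have "rec_nat 1 (\<lambda>i y. m * y) n = m ^ n" for n by (induction n) auto
  ultimately show ?thesis by simp
qed

section \<open>Codes of pairs and lists, access to the oracle\<close>

lemma effective_prod_encode [effective_intros]:
  assumes "effective \<nu> a f" "effective \<nu> a g"
  shows "effective \<nu> a (\<lambda>p xs. prod_encode (f p xs, g p xs))"
  unfolding prod_encode_def triangle_def prod.case by (intro effective_intros assms)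

text \<open>List codes nest to the right, so the code is built from the last entry to the first:
  after \<open>j\<close> steps it codes the last \<open>j\<close> entries.\<close>

lemma effective_tabulate [effective_intros]:
  assumes b: "effective \<nu> a b" and f: "effective \<nu> (Suc a) (\<lambda>p ys. f p (tl ys) (ys ! 0))"
  shows "effective \<nu> a (\<lambda>p xs. list_encode (map (\<lambda>i. f p xs i) [0..<b p xs]))"
proof -
  let ?r = "\<lambda>p xs. rec_nat 0 (\<lambda>i y. Suc (prod_encode (f p xs (b p xs - Suc i), y)))"
  have b2: "effective \<nu> (Suc (Suc a)) (\<lambda>p ys. b p (tl (tl ys)) - Suc (ys ! 1))"
    using effective_weaken[OF effective_weaken[OF b]] by (intro effective_intros) auto
  \<comment> \<open>The first component computes the index of the entry to be prepended; the others
    drop the previous value and the counter.\<close>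
  let ?gs = "(\<lambda>p ys. b p (tl (tl ys)) - Suc (ys ! 1)) # map (\<lambda>i p ys. ys ! Suc (Suc i)) [0..<a]"
  have "effective \<nu> (length ?gs) (\<lambda>p ys. f p (tl ys) (ys ! 0))" using f by simp
  then have "effective \<nu> (Suc (Suc a)) (\<lambda>p xs. (\<lambda>p ys. f p (tl ys) (ys ! 0)) p (map (\<lambda>g. g p xs) ?gs))"
    by (rule effective_comp) (auto intro!: effective_nth b2[simplified])
  moreover have "map (\<lambda>g. g p xs) (map (\<lambda>i p ys. ys ! Suc (Suc i)) [0..<a]) = tl (tl xs)"
    if "length xs = Suc (Suc a)" for p :: 'a and xs :: "nat list"
    using that by (intro nth_equalityI) (auto simp: nth_tl)
  ultimately have "effective \<nu> (Suc (Suc a)) (\<lambda>p ys. f p (tl (tl ys)) (b p (tl (tl ys)) - Suc (ys ! 1)))"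
    by (subst effective_cong[OF refl, where
          g = "\<lambda>p xs. (\<lambda>p ys. f p (tl ys) (ys ! 0)) p (map (\<lambda>g. g p xs) ?gs)"]) simp_all
  then have "effective \<nu> a (\<lambda>p xs. ?r p xs (b p xs))"
    by (intro effective_intros b) auto
  moreover have "?r p xs j = list_encode (map (f p xs) [b p xs - j..<b p xs])" if "j \<le> b p xs" for p xs j
    using that
  proof (induction j)
    case (Suc j)
    then have "[b p xs - Suc j..<b p xs] = (b p xs - Suc j) # [b p xs - j..<b p xs]"
      by (subst upt_conv_Cons) (auto simp: Suc_diff_Suc)
    with Suc show ?case by simp
  qed simp
  ultimately show ?thesis by simp
qed

text \<open>Bounded search replaces inversion of the pairing: at most one summand is non-zero, as
  \<open>prod_encode\<close> is injective, and components never exceed the code.\<close>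

definition code_tl :: "nat \<Rightarrow> nat" where
  "code_tl y = (\<Sum>b<y. b * of_bool (\<exists>a<y. y = Suc (prod_encode (a, b))))"

lemma code_tl_0: "code_tl 0 = 0"
  by (simp add: code_tl_def)

lemma code_tl_Suc: "code_tl (Suc (prod_encode (a, b))) = b"
proof -
  have "b < Suc (prod_encode (a, b))" "a < Suc (prod_encode (a, b))"
    using le_prod_encode_1[of a b] le_prod_encode_2[of b a] by auto
  moreover have "code_tl (Suc (prod_encode (a, b))) =
      (\<Sum>b'<Suc (prod_encode (a, b)). if b' = b then b else 0)"
    unfolding code_tl_def using calculation by (intro sum.cong refl) auto
  ultimately show ?thesis by (simp del: sum.lessThan_Suc)
qed

lemma code_tl_iterate: "rec_nat (list_encode xs) (\<lambda>_. code_tl) i = list_encode (drop i xs)"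
proof (induction i)
  case (Suc i)
  moreover have "drop (Suc i) xs = tl (drop i xs)" by (simp add: drop_Suc tl_drop)
  ultimately show ?case by (cases "drop i xs") (simp_all add: code_tl_0 code_tl_Suc)
qed simp

text \<open>This makes reading an entry a bounded test. Beyond the end of the list the code is 0 and
  no \<open>a\<close> passes.\<close>

lemma list_encode_drop_iff:
  "(\<exists>b<list_encode (drop i xs). list_encode (drop i xs) = Suc (prod_encode (a, b)))
     \<longleftrightarrow> i < length xs \<and> a = xs ! i"
proof (cases "i < length xs")
  case True
  then have "drop i xs = xs ! i # drop (Suc i) xs" by (simp add: Cons_nth_drop_Suc)
  then show ?thesis using True le_prod_encode_2[of "list_encode (drop (Suc i) xs)" "xs ! i"] by auto
qed simp

lemma eval_Proj_iff: "eval_rec (Proj i) xs y \<longleftrightarrow> i < length xs \<and> y = xs ! i"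
  by (auto elim: eval_ProjE intro: ev_Proj)

lemma eval_Z_iff: "eval_rec Z xs y \<longleftrightarrow> y = 0"
  by (auto elim: eval_ZE intro: ev_Z)

text \<open>The unbounded search never ends beyond the prefix, as required of an oracle access.\<close>

lemma nth_recf:
  "\<exists>c. \<forall>i xs y. eval_rec c [i, list_encode xs] y \<longleftrightarrow> i < length xs \<and> y = xs ! i"
proof -
  \<comment> \<open>The three entries of \<open>xs\<close> are a candidate value, an index and a
    list code; \<open>?f\<close> vanishes exactly if the candidate is the entry at that
    index.\<close>
  let ?t = "\<lambda>xs. rec_nat (xs ! 2) (\<lambda>_. code_tl) (xs ! 1)"
  let ?f = "\<lambda>xs. of_bool (\<not> (\<exists>b<?t xs. ?t xs = Suc (prod_encode (xs ! 0, b)))) :: nat"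
  have tl: "effective \<nu> a (\<lambda>p xs. code_tl (g p xs))" if "effective \<nu> a g"
    for \<nu> :: "unit \<Rightarrow> nat \<Rightarrow> nat" and a g
  proof (rule effective_comp1[where f = "\<lambda>p. code_tl", OF _ that])
    show "effective \<nu> 1 (\<lambda>p xs. code_tl (xs ! 0))"
      unfolding code_tl_def by (intro effective_intros) auto
  qed
  \<comment> \<open>A trivial oracle with constant approximation 0 turns the closure rules into a
    statement on total recursive functions; \<open>Z\<close> in \<open>?d\<close> supplies the dummy
    argument.\<close>
  have "effective (\<lambda>_ :: unit. \<lambda>_. 0) 3 (\<lambda>_. ?f)"
    by (intro effective_intros tl) auto
  then obtain c where c1: "\<And>xs y. length xs = 3 \<Longrightarrow> eval_rec c (xs @ [0]) y \<Longrightarrow> y = ?f xs"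
    and c2: "\<And>xs. length xs = 3 \<Longrightarrow> eval_rec c (xs @ [0]) (?f xs)"
    unfolding effective_def by auto
  let ?d = "Comp c [Proj 0, Proj 1, Proj 2, Z]"
  have d: "eval_rec ?d [a, i, list_encode xs] y \<longleftrightarrow> y = of_bool (\<not> (i < length xs \<and> a = xs ! i))" for a i xs y
  proof -
    have f: "?f [a, i, list_encode xs] = of_bool (\<not> (i < length xs \<and> a = xs ! i))"
      by (simp add: code_tl_iterate list_encode_drop_iff)
    show ?thesis
    proof
      assume "eval_rec ?d [a, i, list_encode xs] y"
      then obtain ys where ys: "length ys = length [Proj 0, Proj 1, Proj 2, Z]"
        "\<forall>j<length [Proj 0, Proj 1, Proj 2, Z].
           eval_rec ([Proj 0, Proj 1, Proj 2, Z] ! j) [a, i, list_encode xs] (ys ! j)"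
        "eval_rec c ys y"
        by (rule eval_CompE)
      from ys(1) obtain y0 y1 y2 y3 where eq: "ys = [y0, y1, y2, y3]"
        by (auto simp: length_Suc_conv)
      have "y0 = a" "y1 = i" "y2 = list_encode xs" "y3 = 0"
        using ys(2)[rule_format, of 0] ys(2)[rule_format, of 1] ys(2)[rule_format, of 2]
          ys(2)[rule_format, of 3] unfolding eq by (simp_all add: eval_Proj_iff eval_Z_iff)
      with ys(3) c1[of "[a, i, list_encode xs]" y] show "y = of_bool (\<not> (i < length xs \<and> a = xs ! i))"
        unfolding f eq by simp
    next
      assume y: "y = of_bool (\<not> (i < length xs \<and> a = xs ! i))"
      have "eval_rec c [a, i, list_encode xs, 0] y"
        using c2[of "[a, i, list_encode xs]"] unfolding f y by simp
      moreover have "\<forall>j<length [Proj 0, Proj 1, Proj 2, Z].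
          eval_rec ([Proj 0, Proj 1, Proj 2, Z] ! j) [a, i, list_encode xs]
            ([a, i, list_encode xs, 0] ! j)"
        by (simp add: less_Suc_eq all_conj_distrib eval_Proj_iff eval_Z_iff numeral_2_eq_2)
      moreover have "length [a, i, list_encode xs, 0] = length [Proj 0, Proj 1, Proj 2, Z]" by simp
      ultimately show "eval_rec ?d [a, i, list_encode xs] y"
        by (intro ev_Comp)
    qed
  qed
  show ?thesis
  proof (intro exI[of _ "Mn ?d"] allI)
    fix i xs y
    show "eval_rec (Mn ?d) [i, list_encode xs] y \<longleftrightarrow> i < length xs \<and> y = xs ! i"
    proof
      assume "eval_rec (Mn ?d) [i, list_encode xs] y"
      then have "eval_rec ?d [y, i, list_encode xs] 0" by (rule eval_MnE)
      then show "i < length xs \<and> y = xs ! i" unfolding d by simp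
    next
      assume "i < length xs \<and> y = xs ! i"
      then show "eval_rec (Mn ?d) [i, list_encode xs] y"
        by (intro ev_Mn) (simp_all only: d, simp_all)
    qed
  qed
qed

lemma effective_oracle [effective_intros]:
  assumes "effective prefix_code a f"
  shows "effective prefix_code a (\<lambda>p xs. p (f p xs))"
proof (rule effective_comp1[where f = "\<lambda>p. p", OF _ assms])
  obtain c where c: "\<forall>i xs y. eval_rec c [i, list_encode xs] y \<longleftrightarrow> i < length xs \<and> y = xs ! i"
    using nth_recf ..
  show "effective prefix_code 1 (\<lambda>p xs. p (xs ! 0))"
  proof (rule effectiveI[where c = c])
    fix p and xs :: "nat list"
    assume "length xs = 1"
    then obtain i where xs: "xs = [i]" by (auto simp: length_Suc_conv)
    have *: "eval_rec c [i, prefix_code p k] y \<longleftrightarrow> i < k \<and> y = p i" for k y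
    proof -
      have "eval_rec c [i, prefix_code p k] y \<longleftrightarrow> i < length (map p [0..<k]) \<and> y = map p [0..<k] ! i"
        unfolding prefix_code_def by (rule c[rule_format])
      then show ?thesis by auto
    qed
    show "\<forall>\<^sub>F k in sequentially. eval_rec c (xs @ [prefix_code p k]) (p (xs ! 0))"
      using eventually_gt_at_top[of i] by eventually_elim (simp add: * xs)
    show "y = p (xs ! 0)" if "eval_rec c (xs @ [prefix_code p k]) y" for k y
      using that by (simp add: * xs)
  qed
qed

lemma computable_effective:
  assumes "effective prefix_code 1 (\<lambda>p xs. f p (xs ! 0))"
  shows "computable (\<lambda>p. Some (f p))"
proof -
  obtain c where c: "\<And>p xs k y. length xs = 1 \<Longrightarrow> eval_rec c (xs @ [prefix_code p k]) y \<Longrightarrow> y = f p (xs ! 0)"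
    "\<And>p xs. length xs = 1 \<Longrightarrow> \<forall>\<^sub>F k in sequentially. eval_rec c (xs @ [prefix_code p k]) (f p (xs ! 0))"
    using assms unfolding effective_def by blast
  have "y = f p n" if "eval_rec c [n, prefix_code p k] y" for p n k y
    using c(1)[of "[n]"] that by simp
  moreover have "\<exists>k. eval_rec c [n, prefix_code p k] (f p n)" for p n
    using c(2)[of "[n]" p] by (auto simp: eventually_sequentially)
  ultimately show ?thesis unfolding computable_def by (intro exI[of _ c]) auto
qed

section \<open>Trees with finitely many paths\<close>

text \<open>Continuity: a halting computation on a prefix code is shared by all arguments with that
  prefix, and its value is correct for each of them in the domain.\<close>

lemma computable_finite_use:
  assumes "computable F" "F p = Some q"
  shows "\<exists>k. \<forall>p' q'. (\<forall>i<k. p' i = p i) \<longrightarrow> F p' = Some q' \<longrightarrow> q' n = q n"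
proof -
  obtain c where c: "\<forall>p q. F p = Some q \<longrightarrow>
      (\<forall>n k y. eval_rec c [n, prefix_code p k] y \<longrightarrow> y = q n) \<and>
      (\<forall>n. \<exists>k. eval_rec c [n, prefix_code p k] (q n))"
    using assms(1) unfolding computable_def by blast
  then obtain k where k: "eval_rec c [n, prefix_code p k] (q n)"
    using assms(2) by blast
  have "q' n = q n" if "\<forall>i<k. p' i = p i" "F p' = Some q'" for p' q'
  proof -
    have "prefix_code p' k = prefix_code p k"
      unfolding prefix_code_def using that(1) by (intro arg_cong[of _ _ list_encode] map_cong) auto
    with c that(2) k show ?thesis by metis
  qed
  then show ?thesis by blast
qed

text \<open>\<open>k\<close> is a modulus of continuity of \<open>F\<close> at \<open>p\<close> for
  the output places in \<open>A\<close>; a common one for finite \<open>A\<close> is a maximum of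
  moduli for single places.\<close>

definition determines :: "(baire \<Rightarrow> baire option) \<Rightarrow> baire \<Rightarrow> baire \<Rightarrow> nat set \<Rightarrow> nat \<Rightarrow> bool" where
  "determines F p q A k \<longleftrightarrow>
     (\<forall>p' q'. (\<forall>i<k. p' i = p i) \<longrightarrow> F p' = Some q' \<longrightarrow> (\<forall>n\<in>A. q' n = q n))"

lemma determinesD:
  "determines F p q A k \<Longrightarrow> (\<And>i. i < k \<Longrightarrow> p' i = p i) \<Longrightarrow> F p' = Some q' \<Longrightarrow> n \<in> A \<Longrightarrow> q' n = q n"
  unfolding determines_def by blast

lemma computable_determines:
  assumes "computable F" "F p = Some q" "finite A"
  shows "\<exists>k. determines F p q A k"
proof -
  have "\<forall>n. \<exists>k. determines F p q {n} k"
    using computable_finite_use[OF assms(1), OF assms(2)] by (simp add: determines_def)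
  from choice[OF this] obtain k where k: "\<forall>n. determines F p q {n} (k n)" ..
  have "k n \<le> Max (k ` A)" if "n \<in> A" for n
    using that assms(3) by simp
  then have "determines F p q A (Max (k ` A))"
    unfolding determines_def
    by (intro allI impI ballI determinesD[OF k[rule_format]]) (auto intro: less_le_trans)
  then show ?thesis ..
qed

section \<open>Paths of trees that eventually stop branching\<close>

lemma is_treeI:
  assumes "\<And>w b. w @ [b] \<in> T \<Longrightarrow> w \<in> T" shows "is_tree T"
proof -
  have "w @ v \<in> T \<Longrightarrow> w \<in> T" for w v
    by (induction v rule: rev_induct) (use assms in \<open>auto simp flip: append_assoc\<close>)
  then show ?thesis by (simp add: is_tree_def)
qed

lemma is_tree_take: "is_tree T \<Longrightarrow> w \<in> T \<Longrightarrow> take k w \<in> T"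
  unfolding is_tree_def by (metis append_take_drop_id)

lemma path_eqI:
  assumes "\<And>k. m \<le> k \<Longrightarrow> map x [0..<k] = map y [0..<k]" shows "x = y"
proof
  fix i
  have "map x [0..<max m (Suc i)] ! i = map y [0..<max m (Suc i)] ! i" by (subst assms) simp_all
  then show "x i = y i" by (simp add: nth_map_upt)
qed

lemma map_upt_take: "k \<le> l \<Longrightarrow> map x [0..<k] = take k (map x [0..<l])"
  by (simp add: take_map)

lemma map_upt_Suc: "map x [0..<Suc k] = map x [0..<k] @ [x k]"
  by simp

text \<open>From level \<open>d\<close> on the next bit is forced, so agreement up to
  \<open>k\<close> propagates.\<close>

lemma path_unique:
  assumes d: "\<forall>w\<in>T. length w \<ge> d \<longrightarrow> card {b. w @ [b] \<in> T} = 1"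
    and xy: "x \<in> paths T" "y \<in> paths T" and eq: "map x [0..<k] = map y [0..<k]" and "k \<ge> d"
  shows "x = y"
proof (rule path_eqI[of k])
  fix l assume "k \<le> l"
  then show "map x [0..<l] = map y [0..<l]"
  proof (induction l rule: dec_induct)
    case (step l)
    have "map x [0..<l] \<in> T" using xy by (simp add: paths_def)
    then have "card {b. map x [0..<l] @ [b] \<in> T} = 1"
      using d[rule_format, of "map x [0..<l]"] step(1) \<open>k \<ge> d\<close> by simp
    then obtain b where b: "{b. map x [0..<l] @ [b] \<in> T} = {b}" by (auto simp: card_1_singleton_iff)
    have "map x [0..<Suc l] \<in> T" "map y [0..<Suc l] \<in> T" using xy unfolding paths_def by blast+
    then have "x l \<in> {b. map x [0..<l] @ [b] \<in> T}" "y l \<in> {b. map x [0..<l] @ [b] \<in> T}"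
      by (simp_all only: map_upt_Suc step.IH mem_Collect_eq)
    then show ?case using b step.IH by auto
  qed (rule eq)
qed

text \<open>Beyond level \<open>d\<close> every vertex has a child; iterating the choice of a child
  yields the path.\<close>

lemma path_extends:
  assumes "is_tree T" and d: "\<forall>w\<in>T. length w \<ge> d \<longrightarrow> card {b. w @ [b] \<in> T} = 1"
    and w: "w \<in> T" "length w \<ge> d"
  shows "\<exists>x\<in>paths T. map x [0..<length w] = w"
proof -
  define s where "s u = u @ [SOME b. u @ [b] \<in> T]" for u
  define e where "e i = (s ^^ i) w" for i
  have sT: "s u \<in> T" if "u \<in> T" "length u \<ge> d" for u
  proof -
    have "card {b. u @ [b] \<in> T} = 1" using d that by blast
    then have "\<exists>b. u @ [b] \<in> T" by (auto simp: card_1_singleton_iff)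
    then show ?thesis unfolding s_def by (rule someI_ex)
  qed
  have e: "e i \<in> T \<and> length (e i) = length w + i" for i
  proof (induction i)
    case (Suc i)
    then show ?case using sT[of "e i"] w by (simp add: e_def s_def)
  qed (use w in \<open>simp add: e_def\<close>)
  have pre: "take (length (e i)) (e j) = e i" if "i \<le> j" for i j
    using that
  proof (induction j rule: dec_induct)
    case (step j)
    have "e (Suc j) = s (e j)" by (simp add: e_def)
    with step e[of i] e[of j] show ?case by (simp add: s_def)
  qed simp
  \<comment> \<open>\<open>e (Suc i)\<close> is the first iterate certain to have a place
    \<open>i\<close>, even if \<open>w\<close> is empty.\<close>
  define x where "x i = e (Suc i) ! i" for i
  have xe: "map x [0..<length (e i)] = e i" for i
  proof (rule nth_equalityI)
    fix j assume "j < length (map x [0..<length (e i)])"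
    then have j: "j < length (e i)" by simp
    show "map x [0..<length (e i)] ! j = e i ! j"
    proof (cases "i \<le> Suc j")
      case True
      then have "take (length (e i)) (e (Suc j)) ! j = e i ! j" by (simp only: pre)
      then show ?thesis using j by (simp add: x_def)
    next
      case False
      then have "take (length (e (Suc j))) (e i) ! j = e (Suc j) ! j" by (simp only: pre)
      moreover have "j < length (e (Suc j))" using e[of "Suc j"] by simp
      ultimately have "e (Suc j) ! j = e i ! j" by simp
      then show ?thesis using j by (simp add: x_def)
    qed
  qed simp
  have "map x [0..<k] \<in> T" for k
  proof -
    have "map x [0..<k] = take k (map x [0..<length (e k)])"
      using e[of k] by (intro map_upt_take) simp
    then show ?thesis using is_tree_take[OF assms(1), of "e k" k] e[of k] xe[of k] by simp
  qed
  then have "x \<in> paths T" by (simp add: paths_def)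
  moreover have "map x [0..<length w] = w" using xe[of 0] by (simp add: e_def)
  ultimately show ?thesis by blast
qed

lemma card_m_tree_level:
  assumes "card_m_tree m T" "2 ^ k \<ge> m"
  shows "card {w \<in> T. length w = k} = m"
  using assms by (simp add: card_m_tree_def)

lemma finite_level: "finite {w \<in> T. length w = k}" for T :: "bool list set"
  by (rule finite_subset[OF _ finite_lists_length_eq[of UNIV k]]) auto

text \<open>Once branching has stopped, \<open>path_unique\<close> gives injectivity and
  \<open>path_extends\<close> surjectivity.\<close>

lemma card_m_tree_paths:
  assumes "card_m_tree m T"
  shows "\<exists>d. 2 ^ d \<ge> m \<and> (\<forall>k\<ge>d. bij_betw (\<lambda>x. map x [0..<k]) (paths T) {w \<in> T. length w = k})"
proof -
  obtain d where tree: "is_tree T" and d: "\<forall>w\<in>T. length w \<ge> d \<longrightarrow> card {b. w @ [b] \<in> T} = 1"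
    using assms by (auto simp: card_m_tree_def)
  show ?thesis
  proof (intro exI[of _ "max d m"] conjI allI impI)
    have "m \<le> 2 ^ m" by (simp add: less_imp_le)
    also have "\<dots> \<le> (2 :: nat) ^ max d m" by (intro power_increasing) auto
    finally show "m \<le> 2 ^ max d m" .
    fix k assume k: "k \<ge> max d m"
    show "bij_betw (\<lambda>x. map x [0..<k]) (paths T) {w \<in> T. length w = k}"
    proof (rule bij_betw_imageI)
      show "inj_on (\<lambda>x. map x [0..<k]) (paths T)"
        using k by (intro inj_onI path_unique[OF d, where k = k]) auto
      show "(\<lambda>x. map x [0..<k]) ` paths T = {w \<in> T. length w = k}"
      proof (intro equalityI subsetI)
        fix w assume w: "w \<in> {w \<in> T. length w = k}"
        then obtain x where "x \<in> paths T" "map x [0..<length w] = w"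
          using path_extends[OF tree d, of w] k by auto
        then show "w \<in> (\<lambda>x. map x [0..<k]) ` paths T" using w by (intro image_eqI[of _ _ x]) auto
      qed (auto simp: paths_def)
    qed
  qed
qed

lemma card_m_tree_card_paths:
  assumes "card_m_tree m T"
  shows "finite (paths T)" "card (paths T) = m"
proof -
  obtain d where d: "2 ^ d \<ge> m" "\<And>k. k \<ge> d \<Longrightarrow> bij_betw (\<lambda>x. map x [0..<k]) (paths T) {w \<in> T. length w = k}"
    using card_m_tree_paths[OF assms] by blast
  from bij_betw_finite[OF d(2)[of d]] bij_betw_same_card[OF d(2)[of d]]
  show "finite (paths T)" "card (paths T) = m"
    using finite_level[of T d] card_m_tree_level[OF assms d(1)] by auto
qed

text \<open>An empty value encodes being outside the domain; a tree with \<open>m \<ge> 1\<close>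
  paths has a non-empty value.\<close>

lemma C_card_nonempty_iff: "m \<ge> 1 \<Longrightarrow> C_card m T \<noteq> {} \<longleftrightarrow> card_m_tree m T"
  using card_m_tree_card_paths[of m T] by (auto simp: C_card_def)

section \<open>Names of trees\<close>

definition tree_name :: "bool list set \<Rightarrow> baire" where
  "tree_name T m = of_bool (\<exists>w\<in>T. m = word_code w)"

lemma word_code_inject: "word_code v = word_code w \<longleftrightarrow> v = w"
proof -
  have "inj (of_bool :: bool \<Rightarrow> nat)" by (rule injI) (simp only: of_bool_eq_iff)
  then show ?thesis by (auto simp: word_code_def list_encode_eq)
qed

lemma delta_tree_name: "is_tree T \<Longrightarrow> delta_tree (tree_name T) = Some T"
  by (auto simp: delta_tree_def tree_name_def word_code_inject Let_def)

lemma delta_tree_mem: "delta_tree p = Some T \<Longrightarrow> w \<in> T \<longleftrightarrow> p (word_code w) = 1"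
  by (auto simp: delta_tree_def Let_def split: if_splits)

lemma length_le_list_encode: "length xs \<le> list_encode xs"
  by (induction xs) (auto intro: le_trans[OF _ le_prod_encode_2])

text \<open>Hence the first values of a name concern short words only, and the search for the word
  with a given code can be bounded by that code.\<close>

lemma length_le_word_code: "length w \<le> word_code w"
  using length_le_list_encode[of "map of_bool w"] by (simp add: word_code_def)

section \<open>The lower bound\<close>

lemma delta_cantor_of_bool: "delta_cantor (\<lambda>i. of_bool (x i)) = Some x"
  by (auto simp: delta_cantor_def)

lemma delta_cantor_value:
  assumes "delta_cantor q = Some z" shows "q i = of_bool (z i)"
proof -
  have "q i \<le> 1" "z i \<longleftrightarrow> q i = 1" using assms by (auto simp: delta_cantor_def split: if_splits)
  then show ?thesis by (cases "q i") auto
qed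

text \<open>Realizers are eliminated: a realizer may answer with any point of \<open>g U\<close>, so
  \<open>K\<close> must cope with each of them, while \<open>H p\<close> does not depend on the
  answer.\<close>

lemma weihrauch_le_choice:
  assumes "weihrauch_le delta_tree delta_cantor f delta_tree delta_cantor g"
  obtains K H where "computable K" "computable H"
    "\<forall>p T. delta_tree p = Some T \<longrightarrow> f T \<noteq> {} \<longrightarrow>
       (\<exists>r U. H p = Some r \<and> delta_tree r = Some U \<and> g U \<noteq> {} \<and>
         (\<forall>y\<in>g U. \<exists>q z. K (pairing p (\<lambda>i. of_bool (y i))) = Some q \<and> delta_cantor q = Some z \<and> z \<in> f T))"
proof -
  obtain K H where KH: "computable K" "computable H" and red:
    "\<And>G. realizes delta_tree delta_cantor g G \<Longrightarrow>
        realizes delta_tree delta_cantor f (\<lambda>p. case H p of None \<Rightarrow> None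
          | Some r \<Rightarrow> (case G r of None \<Rightarrow> None | Some s \<Rightarrow> K (pairing p s)))"
    using assms unfolding weihrauch_le_def by blast
  \<comment> \<open>The realizer that answers with a selected point, which depends on the tree but
    not on its name.\<close>
  define G where "G c r = (case delta_tree r of None \<Rightarrow> None
      | Some U \<Rightarrow> if g U = {} then None else Some (\<lambda>i. of_bool (c U i) :: nat))"
    for c :: "bool list set \<Rightarrow> nat \<Rightarrow> bool" and r :: baire
  have G: "realizes delta_tree delta_cantor g (G c)" if "\<And>U. g U \<noteq> {} \<Longrightarrow> c U \<in> g U" for c
    using that by (auto simp: realizes_def G_def delta_cantor_of_bool)
  have main: "\<exists>r U q z. H p = Some r \<and> delta_tree r = Some U \<and> g U \<noteq> {} \<and>
      K (pairing p (\<lambda>i. of_bool (c U i))) = Some q \<and> delta_cantor q = Some z \<and> z \<in> f T"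
    if p: "delta_tree p = Some T" "f T \<noteq> {}" and c: "\<And>U. g U \<noteq> {} \<Longrightarrow> c U \<in> g U" for p T c
  proof -
    obtain q z where q: "(case H p of None \<Rightarrow> None
        | Some r \<Rightarrow> (case G c r of None \<Rightarrow> None | Some s \<Rightarrow> K (pairing p s))) = Some q"
      "delta_cantor q = Some z" "z \<in> f T"
      using red[OF G[OF c]] p unfolding realizes_def by blast
    then show ?thesis
      by (auto simp: G_def split: option.splits if_splits)
  qed
  have "\<exists>r U. H p = Some r \<and> delta_tree r = Some U \<and> g U \<noteq> {} \<and>
      (\<forall>y\<in>g U. \<exists>q z. K (pairing p (\<lambda>i. of_bool (y i))) = Some q \<and> delta_cantor q = Some z \<and> z \<in> f T)"
    if p: "delta_tree p = Some T" "f T \<noteq> {}" for p T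
  proof -
    define c where "c U = (SOME y. y \<in> g U)" for U
    have c: "g U \<noteq> {} \<Longrightarrow> c U \<in> g U" for U by (simp add: c_def some_in_eq)
    obtain r U where rS: "H p = Some r" "delta_tree r = Some U" "g U \<noteq> {}"
      using main[OF p c] by blast
    have "\<exists>q z. K (pairing p (\<lambda>i. of_bool (y i))) = Some q \<and> delta_cantor q = Some z \<and> z \<in> f T"
      if y: "y \<in> g U" for y
    proof -
      \<comment> \<open>A prescribed \<open>y\<close> is the answer of the selection altered at
        \<open>U\<close> alone.\<close>
      have "g U' \<noteq> {} \<Longrightarrow> (c(U := y)) U' \<in> g U'" for U' using y c[of U'] by auto
      from main[OF p this] rS show ?thesis by auto
    qed
    with rS show ?thesis by blast
  qed
  with KH show thesis by (intro that[of K H]) blast+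
qed

text \<open>The prefixes of length \<open>k\<close> of the sequences in \<open>Y k\<close> form
  level \<open>k\<close>; letting \<open>Y k\<close> vary allows branches to die and to be
  replaced.\<close>

definition levels :: "(nat \<Rightarrow> (nat \<Rightarrow> bool) set) \<Rightarrow> bool list set" where
  "levels Y = {w. \<exists>y\<in>Y (length w). w = map y [0..<length w]}"

lemma levels_level: "{w \<in> levels Y. length w = k} = (\<lambda>y. map y [0..<k]) ` Y k"
  by (auto simp: levels_def)

lemma map_in_levels: "y \<in> Y k \<Longrightarrow> map y [0..<k] \<in> levels Y"
  by (auto simp: levels_def)

lemma is_tree_levels:
  assumes "\<And>k y. y \<in> Y (Suc k) \<Longrightarrow> \<exists>y'\<in>Y k. \<forall>i<k. y' i = y i"
  shows "is_tree (levels Y)"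
proof (rule is_treeI)
  fix w b assume "w @ [b] \<in> levels Y"
  then obtain y where y: "y \<in> Y (Suc (length w))" "w @ [b] = map y [0..<Suc (length w)]"
    by (auto simp: levels_def)
  obtain y' where y': "y' \<in> Y (length w)" "\<forall>i<length w. y' i = y i" using assms y(1) by blast
  have "w = map y [0..<length w]" using y(2) by simp
  also have "\<dots> = map y' [0..<length w]" using y'(2) by simp
  finally show "w \<in> levels Y" using y'(1) unfolding levels_def by blast
qed

text \<open>Once \<open>Y\<close> is constant and its members are separated, every vertex continues
  along the only sequence through it.\<close>

lemma card_m_tree_levels:
  assumes tree: "\<And>k y. y \<in> Y (Suc k) \<Longrightarrow> \<exists>y'\<in>Y k. \<forall>i<k. y' i = y i"
    and card: "\<And>k. 2 ^ k \<ge> m \<Longrightarrow> card ((\<lambda>y. map y [0..<k]) ` Y k) = m"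
    and lim: "\<And>k. k \<ge> d \<Longrightarrow> Y k = A"
    and inj: "inj_on (\<lambda>y. map y [0..<d]) A"
  shows "card_m_tree m (levels Y)"
proof -
  have "card {b. w @ [b] \<in> levels Y} = 1" if w: "w \<in> levels Y" "length w \<ge> d" for w
  proof -
    obtain y where y: "y \<in> A" "w = map y [0..<length w]"
      using w lim[of "length w"] by (auto simp: levels_def)
    have "b = y (length w)" if b: "w @ [b] \<in> levels Y" for b
    proof -
      obtain y' where "y' \<in> Y (length (w @ [b]))" "w @ [b] = map y' [0..<length (w @ [b])]"
        using b unfolding levels_def by blast
      then have y': "y' \<in> A" "w @ [b] = map y' [0..<Suc (length w)]"
        using lim[of "Suc (length w)"] w by auto
      have "map y [0..<length w] = map y' [0..<length w]" using y y' by simp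
      then have "map y [0..<d] = map y' [0..<d]" using w(2) by auto
      with inj y(1) y'(1) have "y = y'" by (auto dest: inj_onD)
      with y'(2) show ?thesis by simp
    qed
    moreover have "w @ [y (length w)] = map y [0..<Suc (length w)]"
      using y(2) by simp
    then have "w @ [y (length w)] \<in> levels Y"
      using map_in_levels[of y Y "Suc (length w)"] lim[of "Suc (length w)"] y(1) w(2) by simp
    ultimately have "{b. w @ [b] \<in> levels Y} = {y (length w)}" by blast
    then show ?thesis by simp
  qed
  then show ?thesis
    unfolding card_m_tree_def levels_level using is_tree_levels[of Y] tree card by blast
qed

text \<open>Distinct words of length \<open>L\<close> are continued by \<open>False\<close> forever;
  the constant tails leave every later position free to mark a new branch by
  \<open>True\<close>.\<close>

lemma exists_separated_paths:
  assumes "n < 2 ^ L"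
  shows "\<exists>\<alpha> :: nat \<Rightarrow> nat \<Rightarrow> bool. inj_on (\<lambda>i. map (\<alpha> i) [0..<L]) {..n} \<and> (\<forall>i. \<forall>j\<ge>L. \<not> \<alpha> i j)"
proof -
  have "card {w :: bool list. length w = L} = 2 ^ L"
    using card_lists_length_eq[of "UNIV :: bool set" L] by simp
  moreover have "finite {w :: bool list. length w = L}"
    using finite_lists_length_eq[of "UNIV :: bool set" L] by simp
  ultimately obtain f where f: "f ` {..n} \<subseteq> {w :: bool list. length w = L}" "inj_on f {..n}"
    using card_le_inj[of "{..n}" "{w :: bool list. length w = L}"] assms by auto
  define \<alpha> where "\<alpha> i j = (j < L \<and> f i ! j)" for i j
  have "map (\<alpha> i) [0..<L] = f i" if "i \<le> n" for i
  proof -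
    have "length (f i) = L" using f(1) that by auto
    then show ?thesis by (auto simp: \<alpha>_def intro!: nth_equalityI)
  qed
  then have "inj_on (\<lambda>i. map (\<alpha> i) [0..<L]) {..n}" using f(2) by (subst inj_on_cong[where g = f]) auto
  moreover have "\<forall>i. \<forall>j\<ge>L. \<not> \<alpha> i j" by (simp add: \<alpha>_def)
  ultimately show ?thesis by blast
qed

text \<open>Up to level \<open>M\<close> the tree has the paths \<open>\<alpha> 0, \<dots>, \<alpha> n\<close>. At level
  \<open>M + i + 1\<close> the path \<open>\<alpha> i\<close> dies, unless \<open>i = e\<close>, and \<open>\<alpha> e\<close> branches instead.\<close>

definition rerouted :: "(nat \<Rightarrow> nat \<Rightarrow> bool) \<Rightarrow> nat \<Rightarrow> nat \<Rightarrow> nat \<Rightarrow> nat \<Rightarrow> nat \<Rightarrow> bool" where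
  "rerouted \<alpha> M e k i = (if i = e \<or> k \<le> M + i then \<alpha> i else (\<alpha> e)(M + i := True))"

section \<open>Rerouting the branches of a tree beyond level \<open>M\<close>\<close>

context
  fixes \<alpha> :: "nat \<Rightarrow> nat \<Rightarrow> bool" and L n :: nat
  assumes inj: "inj_on (\<lambda>i. map (\<alpha> i) [0..<L]) {..n}" and zero: "\<And>i j. j \<ge> L \<Longrightarrow> \<not> \<alpha> i j"
    and L: "n < 2 ^ L" "\<And>k. n < 2 ^ k \<Longrightarrow> L \<le> k"
begin

lemma separated: "i \<le> n \<Longrightarrow> j \<le> n \<Longrightarrow> i \<noteq> j \<Longrightarrow> \<exists>l<L. \<alpha> i l \<noteq> \<alpha> j l"
  using inj_onD[OF inj, of i j] by (force simp: Ball_def)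

text \<open>A rerouted sequence is recognised by its \<open>True\<close> at position
  \<open>M + i\<close>, where all others are \<open>False\<close>; unchanged ones differ below
  \<open>L\<close> already.\<close>

lemma inj_rerouted:
  assumes "e \<le> n" "L \<le> M" "L \<le> k"
  shows "inj_on (\<lambda>i. map (rerouted \<alpha> M e k i) [0..<k]) {..n}"
proof (rule inj_onI)
  fix i j
  assume ij: "i \<in> {..n}" "j \<in> {..n}"
    and eq: "map (rerouted \<alpha> M e k i) [0..<k] = map (rerouted \<alpha> M e k j) [0..<k]"
  then have eq: "rerouted \<alpha> M e k i l = rerouted \<alpha> M e k j l" if "l < k" for l
    using that by auto
  show "i = j"
  proof (rule ccontr)
    assume "i \<noteq> j"
    consider "i = e \<or> k \<le> M + i" "j = e \<or> k \<le> M + j" | "i \<noteq> e" "M + i < k" | "j \<noteq> e" "M + j < k"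
      by linarith
    then show False
    proof cases
      case 1
      obtain l where "l < L" "\<alpha> i l \<noteq> \<alpha> j l" using separated ij \<open>i \<noteq> j\<close> by auto
      with eq[of l] 1 assms(3) show False by (auto simp: rerouted_def)
    next
      case 2
      with eq[of "M + i"] zero[of "M + i"] assms(2) \<open>i \<noteq> j\<close> show False
        by (auto simp: rerouted_def split: if_splits)
    next
      case 3
      with eq[of "M + j"] zero[of "M + j"] assms(2) \<open>i \<noteq> j\<close> show False
        by (auto simp: rerouted_def split: if_splits)
    qed
  qed
qed

text \<open>Whenever some \<open>\<alpha> i\<close> dies, a branch of \<open>\<alpha> e\<close>
  takes its place, so the number of vertices stays \<open>n + 1\<close>.\<close>

lemma card_m_tree_rerouted:
  assumes "e \<le> n" "L \<le> M"
  shows "card_m_tree (Suc n) (levels (\<lambda>k. rerouted \<alpha> M e k ` {..n}))"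
proof (rule card_m_tree_levels)
  fix k y assume "y \<in> rerouted \<alpha> M e (Suc k) ` {..n}"
  then obtain i where i: "i \<le> n" "y = rerouted \<alpha> M e (Suc k) i" by auto
  show "\<exists>y'\<in>rerouted \<alpha> M e k ` {..n}. \<forall>i<k. y' i = y i"
  proof (cases "k = M + i \<and> i \<noteq> e")
    case True
    \<comment> \<open>Level \<open>Suc k\<close> is the first one at which index \<open>i\<close>
      follows \<open>\<alpha> e\<close>, so the parent lies on \<open>\<alpha> e\<close>.\<close>
    then show ?thesis using i assms(1) by (intro bexI[of _ "rerouted \<alpha> M e k e"]) (auto simp: rerouted_def)
  next
    case False
    then show ?thesis using i by (intro bexI[of _ "rerouted \<alpha> M e k i"]) (auto simp: rerouted_def)
  qed
next
  fix k assume "Suc n \<le> 2 ^ k"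
  \<comment> \<open>By minimality of \<open>L\<close>, no level below \<open>L\<close> has room for
    \<open>n + 1\<close> vertices.\<close>
  then have "L \<le> k" using L(2) by auto
  from card_image[OF inj_rerouted[OF assms this]]
  show "card ((\<lambda>y. map y [0..<k]) ` rerouted \<alpha> M e k ` {..n}) = Suc n" by (simp add: image_image)
next
  \<comment> \<open>From level \<open>Suc (M + n)\<close> on, all indices other than
    \<open>e\<close> have been rerouted.\<close>
  fix k assume "Suc (M + n) \<le> k"
  then show "rerouted \<alpha> M e k ` {..n} = rerouted \<alpha> M e (Suc (M + n)) ` {..n}"
    by (intro image_cong) (auto simp: rerouted_def)
next
  have "inj_on (\<lambda>i. map (rerouted \<alpha> M e (Suc (M + n)) i) [0..<Suc (M + n)]) {..n}"
    using assms by (intro inj_rerouted) auto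
  then show "inj_on (\<lambda>y. map y [0..<Suc (M + n)]) (rerouted \<alpha> M e (Suc (M + n)) ` {..n})"
    by (intro inj_on_imageI) (simp only: comp_def)
qed

lemma card_m_tree_fixed: "card_m_tree (Suc n) (levels (\<lambda>k. \<alpha> ` {..n}))"
proof (rule card_m_tree_levels)
  \<comment> \<open>If rerouting starts only at level \<open>k\<close>, nothing has changed yet on
    that level.\<close>
  have *: "inj_on (\<lambda>i. map (\<alpha> i) [0..<k]) {..n}" if "L \<le> k" for k
    using inj_rerouted[of 0 k k] that by (simp add: rerouted_def)
  show "card ((\<lambda>y. map y [0..<k]) ` \<alpha> ` {..n}) = Suc n" if "Suc n \<le> 2 ^ k" for k
    using card_image[OF *[of k]] L(2)[of k] that by (simp add: image_image)
  show "inj_on (\<lambda>y. map y [0..<L]) (\<alpha> ` {..n})"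
    using *[OF order_refl] by (intro inj_on_imageI) (simp only: comp_def)
qed auto

text \<open>Deep enough, every index follows \<open>\<alpha> e\<close> except for a change at a
  position \<open>M + i \<ge> L\<close>.\<close>

lemma paths_rerouted:
  assumes "e \<le> n" "L \<le> M" "x \<in> paths (levels (\<lambda>k. rerouted \<alpha> M e k ` {..n}))" "j < L"
  shows "x j = \<alpha> e j"
proof -
  let ?k = "Suc (M + n)"
  have "map x [0..<?k] \<in> levels (\<lambda>k. rerouted \<alpha> M e k ` {..n})"
    using assms(3) unfolding paths_def by blast
  then obtain i where "i \<le> n" "map x [0..<?k] = map (rerouted \<alpha> M e ?k i) [0..<?k]"
    by (auto simp: levels_def simp del: upt_Suc)
  moreover have "x j = map x [0..<?k] ! j" using assms by (simp add: nth_map_upt del: upt_Suc)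
  ultimately have "x j = rerouted \<alpha> M e ?k i j" using assms by (simp add: nth_map_upt del: upt_Suc)
  then show ?thesis using \<open>i \<le> n\<close> assms by (auto simp: rerouted_def)
qed

text \<open>Up to level \<open>M\<close> the tree does not reveal which \<open>e\<close> will
  survive.\<close>

lemma rerouted_level: "k \<le> M \<Longrightarrow> rerouted \<alpha> M e k ` {..n} = \<alpha> ` {..n}"
  by (intro image_cong) (auto simp: rerouted_def)

end

theorem C_card_Suc_not_le:
  assumes "n \<ge> 1"
  shows "\<not> weihrauch_le delta_tree delta_cantor (C_card (Suc n)) delta_tree delta_cantor (C_card n)"
proof
  assume "weihrauch_le delta_tree delta_cantor (C_card (Suc n)) delta_tree delta_cantor (C_card n)"
  then obtain K H where K: "computable K" and H: "computable H" and red: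
    "\<forall>p T. delta_tree p = Some T \<longrightarrow> C_card (Suc n) T \<noteq> {} \<longrightarrow>
       (\<exists>r U. H p = Some r \<and> delta_tree r = Some U \<and> C_card n U \<noteq> {} \<and>
         (\<forall>y\<in>C_card n U. \<exists>q z. K (pairing p (\<lambda>i. of_bool (y i))) = Some q \<and>
            delta_cantor q = Some z \<and> z \<in> C_card (Suc n) T))"
    by (rule weihrauch_le_choice)
  have red: "\<exists>r U. H (tree_name T) = Some r \<and> delta_tree r = Some U \<and> card_m_tree n U \<and>
      (\<forall>y\<in>paths U. \<exists>q z. K (pairing (tree_name T) (\<lambda>i. of_bool (y i))) = Some q \<and>
          (\<forall>i. q i = of_bool (z i)) \<and> z \<in> paths T)"
    if T: "card_m_tree (Suc n) T" for T
  proof -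
    have "delta_tree (tree_name T) = Some T" using T by (simp add: card_m_tree_def delta_tree_name)
    moreover have "C_card (Suc n) T \<noteq> {}" using T by (simp add: C_card_nonempty_iff)
    ultimately obtain r U where *: "H (tree_name T) = Some r" "delta_tree r = Some U" "C_card n U \<noteq> {}"
      "\<forall>y\<in>C_card n U. \<exists>q z. K (pairing (tree_name T) (\<lambda>i. of_bool (y i))) = Some q \<and>
            delta_cantor q = Some z \<and> z \<in> C_card (Suc n) T"
      using red by blast
    have U: "card_m_tree n U" using *(3) assms by (simp add: C_card_nonempty_iff)
    have eq: "C_card n U = paths U" "C_card (Suc n) T = paths T" using U T by (simp_all add: C_card_def)
    have "\<exists>q z. K (pairing (tree_name T) (\<lambda>i. of_bool (y i))) = Some q \<and>
        (\<forall>i. q i = of_bool (z i)) \<and> z \<in> paths T" if y: "y \<in> paths U" for y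
    proof -
      obtain q z where "K (pairing (tree_name T) (\<lambda>i. of_bool (y i))) = Some q"
        "delta_cantor q = Some z" "z \<in> paths T"
        using *(4) y unfolding eq by blast
      with delta_cantor_value[of q z] show ?thesis by blast
    qed
    with *(1,2) U show ?thesis by blast
  qed
  define L where "L = (LEAST k. n < 2 ^ k)"
  have L: "n < 2 ^ L" "\<And>k. n < 2 ^ k \<Longrightarrow> L \<le> k"
    unfolding L_def using LeastI[of "\<lambda>k. n < 2 ^ k" n] Least_le[of "\<lambda>k. n < 2 ^ k"]
    by simp_all
  obtain \<alpha> :: "nat \<Rightarrow> nat \<Rightarrow> bool" where
    inj: "inj_on (\<lambda>i. map (\<alpha> i) [0..<L]) {..n}" and zero: "\<And>i j. j \<ge> L \<Longrightarrow> \<not> \<alpha> i j"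
    using exists_separated_paths[OF L(1)] by blast
  note ctx = inj zero L
  let ?T = "levels (\<lambda>k. \<alpha> ` {..n})"
  let ?p = "tree_name ?T"
  obtain r U where rS: "H ?p = Some r" "delta_tree r = Some U" "card_m_tree n U"
    and KS: "\<forall>y\<in>paths U. \<exists>q z. K (pairing ?p (\<lambda>i. of_bool (y i))) = Some q \<and>
          (\<forall>i. q i = of_bool (z i)) \<and> z \<in> paths ?T"
    using red[OF card_m_tree_fixed[OF ctx]] by blast
  from bchoice[OF KS] obtain q where q: "\<forall>y\<in>paths U. \<exists>z. K (pairing ?p (\<lambda>i. of_bool (y i))) = Some (q y) \<and>
          (\<forall>i. q y i = of_bool (z i)) \<and> z \<in> paths ?T" ..
  from bchoice[OF q] obtain z where "\<forall>y\<in>paths U. K (pairing ?p (\<lambda>i. of_bool (y i))) = Some (q y) \<and>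
          (\<forall>i. q y i = of_bool (z y i)) \<and> z y \<in> paths ?T" ..
  then have qz: "\<And>y. y \<in> paths U \<Longrightarrow> K (pairing ?p (\<lambda>i. of_bool (y i))) = Some (q y)"
    "\<And>y i. y \<in> paths U \<Longrightarrow> q y i = of_bool (z y i)"
    by blast+

  \<comment> \<open>Counting: the \<open>n\<close> paths of \<open>U\<close> account for at most
    \<open>n\<close> of the \<open>n + 1\<close> prefixes.\<close>
  have "\<not> (\<lambda>i. map (\<alpha> i) [0..<L]) ` {..n} \<subseteq> (\<lambda>y. map (z y) [0..<L]) ` paths U"
  proof
    assume "(\<lambda>i. map (\<alpha> i) [0..<L]) ` {..n} \<subseteq> (\<lambda>y. map (z y) [0..<L]) ` paths U"
    then have "card ((\<lambda>i. map (\<alpha> i) [0..<L]) ` {..n}) \<le> card ((\<lambda>y. map (z y) [0..<L]) ` paths U)"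
      using card_m_tree_card_paths(1)[OF rS(3)] by (intro card_mono) auto
    also have "\<dots> \<le> card (paths U)"
      using card_m_tree_card_paths(1)[OF rS(3)] by (rule card_image_le)
    finally show False using card_image[OF inj] card_m_tree_card_paths(2)[OF rS(3)] by simp
  qed
  then obtain e where e: "e \<le> n" "map (\<alpha> e) [0..<L] \<notin> (\<lambda>y. map (z y) [0..<L]) ` paths U"
    by blast

  \<comment> \<open>\<open>N y\<close> is a modulus for the first \<open>L\<close> bits of the
    answer computed from \<open>y\<close>; as \<open>paths U\<close> is finite, \<open>N'\<close>
    bounds them all.\<close>
  have "\<forall>y\<in>paths U. \<exists>N. determines K (pairing ?p (\<lambda>i. of_bool (y i))) (q y) {..<L} N"
    by (intro ballI computable_determines[OF K, OF _ finite_lessThan] qz(1))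
  from bchoice[OF this] obtain N where
    N: "\<forall>y\<in>paths U. determines K (pairing ?p (\<lambda>i. of_bool (y i))) (q y) {..<L} (N y)" ..
  define N' where "N' = Max (N ` paths U)"
  have N': "N y \<le> N'" if "y \<in> paths U" for y
    unfolding N'_def using that card_m_tree_card_paths(1)[OF rS(3)] by simp
  obtain d where d: "\<forall>k\<ge>d. bij_betw (\<lambda>x. map x [0..<k]) (paths U) {w \<in> U. length w = k}"
    using card_m_tree_paths[OF rS(3)] by blast
  \<comment> \<open>At level \<open>l\<close> the vertices of \<open>U\<close> are exactly the
    prefixes of its paths, and these prefixes cover all that \<open>K\<close> reads of an
    answer.\<close>
  define l where "l = max d N'"
  have "finite (word_code ` {w. length w = l})"
    using finite_lists_length_eq[of "UNIV :: bool set" l] by simp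
  from computable_determines[OF H, OF rS(1) this]
  obtain M0 where M0: "determines H ?p r (word_code ` {w. length w = l}) M0" ..
  \<comment> \<open>Changes beyond \<open>M\<close> are seen neither by \<open>H\<close> when it
    fixes level \<open>l\<close> of its output (\<open>M0\<close>) nor by \<open>K\<close> when it
    fixes its first \<open>L\<close> bits (\<open>N'\<close>).\<close>
  define M where "M = max L (max N' M0)"

  let ?T' = "levels (\<lambda>k. rerouted \<alpha> M e k ` {..n})"
  let ?p' = "tree_name ?T'"
  have LM: "L \<le> M" by (simp add: M_def)
  obtain r' U' where rS': "H ?p' = Some r'" "delta_tree r' = Some U'" "card_m_tree n U'"
    and KS': "\<forall>y\<in>paths U'. \<exists>q z. K (pairing ?p' (\<lambda>i. of_bool (y i))) = Some q \<and>
          (\<forall>i. q i = of_bool (z i)) \<and> z \<in> paths ?T'"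
    using red[OF card_m_tree_rerouted[OF ctx e(1) LM]] by blast
  have agree: "?p' m = ?p m" if "m \<le> M" for m
  proof -
    have "w \<in> ?T' \<longleftrightarrow> w \<in> ?T" if "m = word_code w" for w
    proof -
      have "length w \<le> M" using length_le_word_code[of w] that \<open>m \<le> M\<close> by simp
      then show ?thesis using rerouted_level[OF ctx] by (simp only: levels_def mem_Collect_eq)
    qed
    then have "(\<exists>w\<in>?T'. m = word_code w) \<longleftrightarrow> (\<exists>w\<in>?T. m = word_code w)" by blast
    then show ?thesis by (simp only: tree_name_def)
  qed
  obtain y' where y': "y' \<in> paths U'"
    using card_m_tree_card_paths[OF rS'(3)] assms by fastforce
  obtain q' z' where q': "K (pairing ?p' (\<lambda>i. of_bool (y' i))) = Some q'"
    "\<forall>i. q' i = of_bool (z' i)" "z' \<in> paths ?T'"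
    using KS' y' by blast
  have "map y' [0..<l] \<in> U'" using y' by (simp add: paths_def)
  \<comment> \<open>Level \<open>l\<close> of the output of \<open>H\<close> is unchanged, so a path
    of \<open>U'\<close> starts like a path of \<open>U\<close>.\<close>
  moreover have "r' (word_code (map y' [0..<l])) = r (word_code (map y' [0..<l]))"
  proof (rule determinesD[OF M0, OF _ rS'(1)])
    show "?p' i = ?p i" if "i < M0" for i using that by (intro agree) (simp add: M_def)
  qed simp
  ultimately have "map y' [0..<l] \<in> U"
    using delta_tree_mem[OF rS(2)] delta_tree_mem[OF rS'(2)] by simp
  then have "map y' [0..<l] \<in> (\<lambda>x. map x [0..<l]) ` paths U"
    using d[rule_format, of l] by (auto simp: l_def bij_betw_def)
  then obtain y where y: "y \<in> paths U" "map y' [0..<l] = map y [0..<l]" by auto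
  \<comment> \<open>The first \<open>N y\<close> places of a pairing read each component below
    \<open>N'\<close> only.\<close>
  have "pairing ?p' (\<lambda>i. of_bool (y' i)) i = pairing ?p (\<lambda>i. of_bool (y i)) i" if "i < N y" for i
  proof -
    have "i div 2 < N'" using that N'[OF y(1)] div_le_dividend[of i 2] by linarith
    then have "i div 2 \<le> M" "i div 2 < l" by (auto simp: M_def l_def)
    then show ?thesis using agree y(2) by (auto simp: pairing_def)
  qed
  then have "q' j = q y j" if "j < L" for j
    using determinesD[OF N[rule_format, OF y(1)], OF _ q'(1), of j] that by simp
  then have "z' j = z y j" if "j < L" for j
    using that q'(2)[rule_format, of j] qz(2)[OF y(1), of j] by (metis of_bool_eq_iff)
  \<comment> \<open>The new answer follows \<open>\<alpha> e\<close>, as all paths of the rerouted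
    tree do, yet it begins like the old answer for \<open>y\<close>, which misses that
    prefix.\<close>
  then have "map (\<alpha> e) [0..<L] = map (z y) [0..<L]"
    using paths_rerouted[OF ctx e(1) LM q'(3)] by auto
  with e(2) y(1) show False by blast
qed

section \<open>Adding one path to a tree\<close>

text \<open>Numbers below \<open>2 ^ k\<close> list the words of length \<open>k\<close> with the
  leading bit first, so the children of \<open>v\<close> are \<open>2 * v\<close> and
  \<open>2 * v + 1\<close> and its parent is \<open>v div 2\<close>.\<close>

definition word :: "nat \<Rightarrow> nat \<Rightarrow> bool list" where
  "word k v = map (\<lambda>i. odd (v div 2 ^ (k - Suc i))) [0..<k]"

lemma length_word [simp]: "length (word k v) = k"
  by (simp add: word_def)

lemma word_Suc: "word (Suc k) v = word k (v div 2) @ [odd v]"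
proof -
  have "v div 2 ^ (k - i) = v div 2 div 2 ^ (k - Suc i)" if "i < k" for i
  proof -
    have "k - i = Suc (k - Suc i)" using that by simp
    then show ?thesis by (simp add: div_mult2_eq)
  qed
  then show ?thesis by (simp add: word_def)
qed

lemma word_inject: "u < 2 ^ k \<Longrightarrow> v < 2 ^ k \<Longrightarrow> word k u = word k v \<longleftrightarrow> u = v"
proof (induction k arbitrary: u v)
  case (Suc k)
  have "word (Suc k) u = word (Suc k) v \<longleftrightarrow> u div 2 = v div 2 \<and> odd u = odd v"
    using Suc.IH[of "u div 2" "v div 2"] Suc.prems by (auto simp: word_Suc)
  also have "\<dots> \<longleftrightarrow> u = v" by presburger
  finally show ?case .
qed simp

lemma word_surj: "\<exists>v<2 ^ length w. w = word (length w) v"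
proof (induction w rule: rev_induct)
  case (snoc b w)
  then obtain v where "v < 2 ^ length w" "w = word (length w) v" by blast
  then show ?case by (intro exI[of _ "2 * v + of_bool b"]) (auto simp: word_Suc)
qed (simp add: word_def)

text \<open>In what follows, \<open>m k v\<close> tells whether the \<open>v\<close>-th word of length \<open>k\<close> is in the tree.\<close>

definition single :: "(nat \<Rightarrow> nat \<Rightarrow> bool) \<Rightarrow> nat \<Rightarrow> nat \<Rightarrow> bool" where
  "single m k v \<longleftrightarrow> v < 2 ^ k \<and> m k v \<and> m (Suc k) (2 * v) \<noteq> m (Suc k) (2 * v + 1)"

definition child :: "(nat \<Rightarrow> nat \<Rightarrow> bool) \<Rightarrow> nat \<Rightarrow> nat \<Rightarrow> nat" where
  "child m k v = 2 * v + of_bool (\<not> m (Suc k) (2 * v))"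

text \<open>For a \<open>single\<close> vertex this is the child that the tree lacks, hence a place
  where the extra branch can leave the tree.\<close>

definition sibling :: "(nat \<Rightarrow> nat \<Rightarrow> bool) \<Rightarrow> nat \<Rightarrow> nat \<Rightarrow> nat" where
  "sibling m k v = 2 * v + of_bool (m (Suc k) (2 * v))"

text \<open>The default \<open>2 ^ k\<close> is never \<open>single\<close>, so testing the result
  also tells whether a vertex was found.\<close>

definition first_single :: "(nat \<Rightarrow> nat \<Rightarrow> bool) \<Rightarrow> nat \<Rightarrow> nat" where
  "first_single m k = (LEAST v. v = 2 ^ k \<or> single m k v)"

text \<open>At level \<open>k = L + i\<close> the label is the vertex of the tree that the extra vertex copies;
  the value \<open>2 ^ k\<close> stands for a missing label.\<close>

primrec label :: "(nat \<Rightarrow> nat \<Rightarrow> bool) \<Rightarrow> nat \<Rightarrow> nat \<Rightarrow> nat" where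
  "label m L 0 = 2 ^ L"
| "label m L (Suc i) =
    (if single m (L + i) (label m L i) then child m (L + i) (label m L i)
     else if single m (L + i) (first_single m (L + i)) then child m (L + i) (first_single m (L + i))
     else 2 ^ Suc (L + i))"

text \<open>While the label has a single child, its new bit is copied; otherwise the branch restarts
  beside a single child or, if there is none, is continued by 0 outside the tree.\<close>

primrec extra :: "(nat \<Rightarrow> nat \<Rightarrow> bool) \<Rightarrow> nat \<Rightarrow> nat \<Rightarrow> nat" where
  "extra m L 0 = (LEAST v. v = 2 ^ L \<or> \<not> m L v)"
| "extra m L (Suc i) =
    (if single m (L + i) (label m L i) then 2 * extra m L i + label m L (Suc i) mod 2
     else if single m (L + i) (first_single m (L + i)) then sibling m (L + i) (first_single m (L + i))
     else 2 * extra m L i)"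

declare label.simps(2) [simp del] extra.simps(2) [simp del]

text \<open>For the least \<open>L\<close> with \<open>n < 2 ^ L\<close>, lower levels have at most
  \<open>n\<close> words and their size is not prescribed; taking all these words supplies the
  ancestors of the extra vertex.\<close>

definition extended :: "nat \<Rightarrow> bool list set \<Rightarrow> bool list set" where
  "extended L T = {w. length w < L \<or> w \<in> T \<or>
     w = word (length w) (extra (\<lambda>k v. word k v \<in> T) L (length w - L))}"

text \<open>The bit changed is the one by which \<open>y\<close> leaves \<open>T\<close>; in a tree
  there is at most one.\<close>

definition flip_exit :: "bool list set \<Rightarrow> (nat \<Rightarrow> bool) \<Rightarrow> nat \<Rightarrow> bool" where
  "flip_exit T y i = (y i \<noteq> (map y [0..<i] \<in> T \<and> map y [0..<Suc i] \<notin> T))"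

lemma single_child: "single m k v \<Longrightarrow> m (Suc k) (child m k v)" "single m k v \<Longrightarrow> child m k v < 2 ^ Suc k"
  by (auto simp: single_def child_def)

lemma single_sibling: "single m k v \<Longrightarrow> \<not> m (Suc k) (sibling m k v)" "single m k v \<Longrightarrow> sibling m k v < 2 ^ Suc k"
  by (auto simp: single_def sibling_def)

lemma child_parity: "child m k v div 2 = v" "odd (child m k v) \<longleftrightarrow> \<not> m (Suc k) (2 * v)"
  by (simp_all add: child_def)

lemma sibling_parity: "sibling m k v div 2 = v" "odd (sibling m k v) \<longleftrightarrow> m (Suc k) (2 * v)"
  by (simp_all add: sibling_def)

lemma single_first_single: "single m k v \<Longrightarrow> single m k (first_single m k)"
proof -
  assume v: "single m k v"
  have "first_single m k = 2 ^ k \<or> single m k (first_single m k)"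
    unfolding first_single_def using v by (intro LeastI[of "\<lambda>v. v = 2 ^ k \<or> single m k v" v]) simp
  moreover have "first_single m k \<le> v" unfolding first_single_def using v by (intro Least_le) simp
  ultimately show ?thesis using v by (auto simp: single_def)
qed

section \<open>The enlarged tree and its paths\<close>

context
  fixes T :: "bool list set" and n L :: nat
  assumes T: "card_m_tree n T" and n: "n \<ge> 1"
    and L: "n < 2 ^ L" "\<And>k. n < 2 ^ k \<Longrightarrow> L \<le> k"
begin

abbreviation (input) "mem \<equiv> \<lambda>k v. word k v \<in> T"

lemma tree: "is_tree T"
  using T by (simp add: card_m_tree_def)

lemma mem_parent: "mem (Suc k) v \<Longrightarrow> mem k (v div 2)"
  using tree unfolding word_Suc is_tree_def by blast

lemma card_level: "L \<le> k \<Longrightarrow> card {w \<in> T. length w = k} = n"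
  using card_m_tree_level[OF T, of k] L(1) power_increasing[of L k "2 :: nat"] by linarith

lemma extra_0: "extra mem L 0 < 2 ^ L" "\<not> mem L (extra mem L 0)"
proof -
  have "\<exists>v<2 ^ L. \<not> mem L v"
  proof (rule ccontr)
    assume "\<not> ?thesis"
    then have "word L ` {..<2 ^ L} \<subseteq> {w \<in> T. length w = L}" by auto
    then have "card (word L ` {..<2 ^ L}) \<le> n"
      using card_mono[OF finite_level] card_level[of L] by fastforce
    moreover have "inj_on (word L) {..<2 ^ L}" by (intro inj_onI) (simp add: word_inject)
    ultimately show False using L(1) by (simp add: card_image)
  qed
  then obtain v where v: "v < 2 ^ L" "\<not> mem L v" by blast
  have "extra mem L 0 \<le> v" using v(2) by (auto intro: Least_le)
  then show *: "extra mem L 0 < 2 ^ L" using v(1) by simp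
  have "extra mem L 0 = 2 ^ L \<or> \<not> mem L (extra mem L 0)"
    using LeastI[of "\<lambda>v. v = 2 ^ L \<or> \<not> mem L v" v] v(2) by simp
  with * show "\<not> mem L (extra mem L 0)" by simp
qed

text \<open>The extra vertex is a missing child or a child of its predecessor, and a tree contains
  no extension of a word outside it.\<close>

lemma extra_not_mem: "extra mem L i < 2 ^ (L + i) \<and> \<not> mem (L + i) (extra mem L i)"
proof (induction i)
  case (Suc i)
  have nm: "\<not> mem (Suc (L + i)) (2 * extra mem L i + b mod 2)" for b
    using mem_parent[of "L + i" "2 * extra mem L i + b mod 2"] Suc by auto
  moreover have lt: "2 * extra mem L i + b mod 2 < 2 ^ Suc (L + i)" for b :: nat
    using Suc by (auto simp: odd_iff_mod_2_eq_one)
  ultimately show ?case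
    using single_sibling[of mem "L + i" "first_single mem (L + i)"] lt[of 0] nm[of 0]
    by (simp add: extra.simps(2))
qed (use extra_0 in simp)

text \<open>At a restart the parent is a vertex of \<open>T\<close>; this keeps the enlarged set a
  tree.\<close>

lemma extra_parent: "mem (L + i) (extra mem L (Suc i) div 2) \<or> extra mem L (Suc i) div 2 = extra mem L i"
proof -
  have "(2 * a + b mod 2) div 2 = a" for a b :: nat by presburger
  then show ?thesis by (auto simp: extra.simps(2) sibling_parity single_def)
qed

text \<open>The invariant between the label \<open>e\<close> and the extra vertex \<open>x\<close>:
  they differ only in the bit by which \<open>x\<close> leaves \<open>T\<close>, and
  \<open>z\<close> is the part copied since then.\<close>

definition related :: "nat \<Rightarrow> nat \<Rightarrow> nat \<Rightarrow> bool" where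
  "related k e x \<longleftrightarrow> (\<exists>a b z. word k e = a @ b # z \<and> word k x = a @ (\<not> b) # z \<and>
     a @ [\<not> b] \<notin> T \<and> mem k e)"

lemma relatedI:
  "word k e = a @ b # z \<Longrightarrow> word k x = a @ (\<not> b) # z \<Longrightarrow> a @ [\<not> b] \<notin> T \<Longrightarrow> mem k e \<Longrightarrow>
    related k e x"
  unfolding related_def by blast

text \<open>Copying a bit lengthens \<open>z\<close>, a restart begins with empty \<open>z\<close>,
  and while the label is missing, as at the start, nothing is claimed.\<close>

lemma related_label: "label mem L i < 2 ^ (L + i) \<Longrightarrow> related (L + i) (label mem L i) (extra mem L i)"
proof (induction i)
  case (Suc i)
  let ?k = "L + i" and ?f = "first_single mem (L + i)"
  show ?case
  proof (cases "single mem ?k (label mem L i)")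
    case True
    then have "related ?k (label mem L i) (extra mem L i)" using Suc.IH by (simp add: single_def)
    then obtain a b z where abz: "word ?k (label mem L i) = a @ b # z"
      "word ?k (extra mem L i) = a @ (\<not> b) # z" "a @ [\<not> b] \<notin> T"
      unfolding related_def by blast
    have l: "label mem L (Suc i) = child mem ?k (label mem L i)" using True by (simp add: label.simps(2))
    have x: "extra mem L (Suc i) = 2 * extra mem L i + label mem L (Suc i) mod 2"
      using True by (simp add: extra.simps(2))
    have "word (Suc ?k) (label mem L (Suc i)) = a @ b # z @ [odd (label mem L (Suc i))]"
      using abz(1) by (simp add: word_Suc child_parity l)
    moreover have "word (Suc ?k) (extra mem L (Suc i)) = a @ (\<not> b) # z @ [odd (label mem L (Suc i))]"
    proof -
      have "(2 * c + d mod 2) div 2 = c" "odd (2 * c + d mod 2) = odd d" for c d :: nat by presburger+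
      then show ?thesis unfolding x word_Suc using abz(2) by simp
    qed
    moreover have "mem (Suc ?k) (label mem L (Suc i))"
      unfolding l by (rule single_child(1)[OF True])
    ultimately show ?thesis unfolding related_def using abz(3) by auto
  next
    case False
    show ?thesis
    proof (cases "single mem ?k ?f")
      case True
      have l: "label mem L (Suc i) = child mem ?k ?f" and x: "extra mem L (Suc i) = sibling mem ?k ?f"
        using True False by (simp_all add: label.simps(2) extra.simps(2))
      define b where "b \<longleftrightarrow> \<not> mem (Suc ?k) (2 * ?f)"
      have e: "word (Suc ?k) (label mem L (Suc i)) = word ?k ?f @ [b]"
        "word (Suc ?k) (extra mem L (Suc i)) = word ?k ?f @ [\<not> b]"
        unfolding l x b_def by (simp_all add: word_Suc child_parity sibling_parity)
      have "word (Suc ?k) (extra mem L (Suc i)) \<notin> T"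
        unfolding x by (rule single_sibling(1)[OF True])
      moreover have "mem (Suc ?k) (label mem L (Suc i))"
        unfolding l by (rule single_child(1)[OF True])
      ultimately show ?thesis
        using e by (intro relatedI[of _ _ "word ?k ?f" b "[]"]) simp_all
    next
      case f: False
      with False Suc.prems show ?thesis by (simp add: label.simps(2))
    qed
  qed
qed simp

text \<open>When \<open>T\<close> has stopped branching, all its vertices are \<open>single\<close>;
  a missing label is then regained in one step and never lost again.\<close>

lemma eventually_single:
  "\<exists>d. \<forall>i\<ge>d. single mem (L + i) (label mem L i) \<and> (\<forall>w\<in>T. length w = L + i \<longrightarrow> card {b. w @ [b] \<in> T} = 1)"
proof -
  obtain d where d: "\<forall>w\<in>T. length w \<ge> d \<longrightarrow> card {b. w @ [b] \<in> T} = 1"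
    using T by (auto simp: card_m_tree_def)
  have all: "single mem k v" if v: "v < 2 ^ k" "mem k v" "d \<le> k" for k v
  proof -
    have "card {b. word k v @ [b] \<in> T} = 1" using d[rule_format, OF v(2)] v(3) by simp
    then obtain b where b: "{b. word k v @ [b] \<in> T} = {b}" by (rule card_1_singletonE)
    have "mem (Suc k) (2 * v) \<longleftrightarrow> False \<in> {b. word k v @ [b] \<in> T}"
      "mem (Suc k) (2 * v + 1) \<longleftrightarrow> True \<in> {b. word k v @ [b] \<in> T}"
      by (simp_all add: word_Suc)
    then show ?thesis unfolding b single_def using v by auto
  qed
  \<comment> \<open>The successor leaves one level for a restart: a label at \<open>Suc j\<close> is
    obtained from a \<open>single\<close> vertex at \<open>j\<close>.\<close>
  have "single mem (L + i) (label mem L i)" if i: "Suc d \<le> i" for i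
  proof -
    obtain j where j: "i = Suc j" "d \<le> j" using i by (cases i) auto
    have "{w \<in> T. length w = L + j} \<noteq> {}"
      using card_level[of "L + j"] n by (metis card.empty le_add1 not_one_le_zero)
    then obtain w where "w \<in> T" "length w = L + j" by blast
    moreover obtain v where "v < 2 ^ length w" "w = word (length w) v" using word_surj by blast
    ultimately have "single mem (L + j) v" using j by (intro all) auto
    then have f: "single mem (L + j) (first_single mem (L + j))" by (rule single_first_single)
    have "mem (Suc (L + j)) (label mem L i) \<and> label mem L i < 2 ^ Suc (L + j)"
      using f single_child[of mem "L + j"] by (simp add: j label.simps(2))
    then show ?thesis using j by (intro all) auto
  qed
  then show ?thesis using d by (intro exI[of _ "Suc d"]) auto
qed

lemma extended_level:
  "L \<le> k \<Longrightarrow> {w \<in> extended L T. length w = k} = insert (word k (extra mem L (k - L))) {w \<in> T. length w = k}"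
  by (auto simp: extended_def)

lemma card_m_tree_extended: "card_m_tree (Suc n) (extended L T)"
  unfolding card_m_tree_def
proof (intro conjI allI impI)
  show "is_tree (extended L T)"
  proof (rule is_treeI)
    fix w b assume w: "w @ [b] \<in> extended L T"
    consider "length w < L" | "w @ [b] \<in> T"
      | "L \<le> length w" "w @ [b] = word (Suc (length w)) (extra mem L (Suc (length w) - L))"
    proof -
      have "Suc (length w) < L \<or> w @ [b] \<in> T \<or>
          w @ [b] = word (Suc (length w)) (extra mem L (Suc (length w) - L))"
        using w by (simp only: extended_def mem_Collect_eq length_append_singleton)
      then show thesis using that not_le Suc_lessD by blast
    qed
    then show "w \<in> extended L T"
    proof cases
      case 2
      then show ?thesis using tree unfolding is_tree_def extended_def by blast
    next
      case 3
      let ?i = "length w - L"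
      have "w = word (length w) (extra mem L (Suc ?i) div 2)"
        using 3 by (simp add: word_Suc Suc_diff_le)
      with extra_parent[of ?i] 3(1) show ?thesis
        by (auto simp: extended_def)
    qed (simp add: extended_def)
  qed
  fix k assume "Suc n \<le> 2 ^ k"
  then have k: "L \<le> k" by (intro L(2)) simp
  moreover have "word k (extra mem L (k - L)) \<notin> T" using extra_not_mem[of "k - L"] k by simp
  ultimately show "card {w \<in> extended L T. length w = k} = Suc n"
    using extended_level[OF k] finite_level[of T k] card_level[OF k] by simp
next
  obtain d where d: "\<forall>i\<ge>d. single mem (L + i) (label mem L i) \<and>
      (\<forall>w\<in>T. length w = L + i \<longrightarrow> card {b. w @ [b] \<in> T} = 1)"
    using eventually_single by blast
  show "\<exists>d. \<forall>w\<in>extended L T. d \<le> length w \<longrightarrow> card {b. w @ [b] \<in> extended L T} = 1"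
  proof (intro exI[of _ "L + d"] ballI impI)
    fix w assume w: "w \<in> extended L T" "L + d \<le> length w"
    define i where "i = length w - L"
    have lw: "length w = L + i" "d \<le> i" using w(2) by (auto simp: i_def)
    \<comment> \<open>From here on the first case of \<open>extra\<close> always applies, so the
      extra branch just grows by one bit per level.\<close>
    have x: "extra mem L (Suc i) = 2 * extra mem L i + label mem L (Suc i) mod 2"
      using d lw(2) by (simp add: extra.simps(2))
    have "(2 * a + b mod 2) div 2 = a" for a b :: nat by presburger
    then have x: "word (Suc (L + i)) (extra mem L (Suc i)) = word (L + i) (extra mem L i) @ [odd (extra mem L (Suc i))]"
      unfolding word_Suc by (simp add: x)
    have ext: "w @ [b] \<in> extended L T \<longleftrightarrow> w @ [b] \<in> T \<or> w = word (L + i) (extra mem L i) \<and> b = odd (extra mem L (Suc i))" for b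
      using lw x by (auto simp: extended_def)
    show "card {b. w @ [b] \<in> extended L T} = 1"
    proof (cases "w \<in> T")
      case True
      \<comment> \<open>A vertex of \<open>T\<close> gains no child, since the new extra vertex
        extends the old one, which lies outside \<open>T\<close>.\<close>
      then have "w \<noteq> word (L + i) (extra mem L i)" using extra_not_mem[of i] by auto
      then show ?thesis unfolding ext using d lw True by auto
    next
      case False
      then have "w = word (L + i) (extra mem L i)" using w(1) lw by (auto simp: extended_def)
      moreover have "w @ [b] \<notin> T" for b using tree False unfolding is_tree_def by blast
      ultimately have "{b. w @ [b] \<in> extended L T} = {odd (extra mem L (Suc i))}" unfolding ext by auto
      then show ?thesis by simp
    qed
  qed
qed

text \<open>A path outside \<open>T\<close> follows the extra vertices from some level on, and
  flipping its exit bit turns them into their labels, which lie in \<open>T\<close>.\<close>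

lemma flip_exit_path:
  assumes y: "y \<in> paths (extended L T)"
  shows "flip_exit T y \<in> paths T"
proof (cases "y \<in> paths T")
  case True
  then have "flip_exit T y = y" by (auto simp: flip_exit_def paths_def simp del: upt_Suc)
  with True show ?thesis by simp
next
  case False
  then obtain j where j: "map y [0..<j] \<notin> T" by (auto simp: paths_def)
  obtain d where d: "\<forall>i\<ge>d. single mem (L + i) (label mem L i)"
    using eventually_single by blast
  have large: "map (flip_exit T y) [0..<k] \<in> T" if k: "j \<le> k" "L + d \<le> k" for k
  proof -
    define i where "i = k - L"
    have ki: "k = L + i" "d \<le> i" using k(2) by (auto simp: i_def)
    have "map y [0..<k] \<notin> T"
      using j is_tree_take[OF tree, of "map y [0..<k]" j] k(1) by (metis map_upt_take)
    moreover have "map y [0..<k] \<in> extended L T" using y by (simp add: paths_def)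
    ultimately have yk: "map y [0..<k] = word k (extra mem L i)"
      using ki(1) by (simp add: extended_def)
    have "label mem L i < 2 ^ (L + i)" using d ki(2) by (simp add: single_def)
    from related_label[OF this] obtain a b z where abz: "word k (label mem L i) = a @ b # z"
      "word k (extra mem L i) = a @ (\<not> b) # z" "a @ [\<not> b] \<notin> T" "mem k (label mem L i)"
      unfolding related_def ki(1) by blast
    have pre: "map y [0..<l] = take l (a @ (\<not> b) # z)" if "l \<le> k" for l
      unfolding map_upt_take[OF that] yk abz(2) ..
    have lk: "k = length a + Suc (length z)" using arg_cong[OF abz(1), of length] by simp
    have aT: "take l a \<in> T" for l
      using is_tree_take[OF tree, of a l] abz(1,4) tree unfolding is_tree_def by metis
    \<comment> \<open>Before position \<open>length a\<close> both prefixes are in \<open>T\<close>,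
      at this position the exit occurs, and later the path is already outside; only one bit is
      flipped.\<close>
    have "map (flip_exit T y) [0..<k] = a @ b # z"
    proof (rule nth_equalityI)
      fix l assume "l < length (map (flip_exit T y) [0..<k])"
      then have l: "l < k" by simp
      have yl: "y l = (a @ (\<not> b) # z) ! l"
        using l yk abz(2) by (metis add.left_neutral diff_zero nth_map_upt)
      have "flip_exit T y l = (a @ b # z) ! l"
      proof (cases l "length a" rule: linorder_cases)
        case less
        then have "map y [0..<Suc l] \<in> T" using pre[of "Suc l"] l aT[of "Suc l"] by simp
        with less yl show ?thesis by (simp add: flip_exit_def nth_append del: upt_Suc)
      next
        case equal
        then have "map y [0..<l] \<in> T" "map y [0..<Suc l] \<notin> T"
          using pre[of l] pre[of "Suc l"] l aT[of l] abz(3) by simp_all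
        with equal yl show ?thesis by (simp add: flip_exit_def nth_append del: upt_Suc)
      next
        case greater
        have "take (Suc (length a)) (map y [0..<l]) = a @ [\<not> b]"
          using pre[of l] l greater by (simp add: min_def)
        then have "map y [0..<l] \<notin> T" using is_tree_take[OF tree] abz(3) by metis
        with greater yl show ?thesis by (simp add: flip_exit_def nth_append del: upt_Suc)
      qed
      then show "map (flip_exit T y) [0..<k] ! l = (a @ b # z) ! l" using l by simp
    qed (simp add: lk)
    with abz(1,4) show ?thesis by simp
  qed
  have "map (flip_exit T y) [0..<k] \<in> T" for k
  proof -
    let ?k = "max k (max j (L + d))"
    have "take k (map (flip_exit T y) [0..<?k]) \<in> T" by (intro is_tree_take[OF tree] large) auto
    then show ?thesis using map_upt_take[of k ?k "flip_exit T y"] by simp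
  qed
  then show ?thesis by (simp add: paths_def)
qed

end

section \<open>The upper bound\<close>

lemma effective_iff [effective_intros]:
  assumes "effective \<nu> a (\<lambda>p xs. of_bool (P p xs))" "effective \<nu> a (\<lambda>p xs. of_bool (Q p xs))"
  shows "effective \<nu> a (\<lambda>p xs. of_bool (P p xs = Q p xs))"
  using effective_eq[OF assms] by (simp add: of_bool_eq_iff)

text \<open>After \<open>i\<close> steps the recursion holds the least \<open>v\<close> with
  \<open>v = i\<close> or \<open>P\<close>: it moves on with the counter as long as nothing has been
  found.\<close>

lemma effective_Least:
  assumes b: "effective \<nu> a b" and P: "effective \<nu> (Suc a) (\<lambda>p ys. of_bool (P p (tl ys) (ys ! 0)))"
  shows "effective \<nu> a (\<lambda>p xs. LEAST v. v = b p xs \<or> P p xs v)"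
proof -
  have "effective \<nu> (Suc (Suc a)) (\<lambda>p ys. of_bool (P p (tl (tl ys)) (tl ys ! 0)))"
    by (rule effective_weaken[OF P])
  moreover have "effective \<nu> (Suc (Suc a)) (\<lambda>p ys. of_bool (P p (tl (tl ys)) (tl ys ! 0))) =
      effective \<nu> (Suc (Suc a)) (\<lambda>p ys. of_bool (P p (tl (tl ys)) (ys ! 1)))"
    by (rule effective_cong) (auto simp: nth_tl)
  ultimately have "effective \<nu> a (\<lambda>p xs. rec_nat 0 (\<lambda>i y. if y = i \<and> \<not> P p xs i then Suc i else y) (b p xs))"
    by (intro effective_intros b) auto
  moreover have "rec_nat 0 (\<lambda>i y. if y = i \<and> \<not> Q i then Suc i else y) n = (LEAST v. v = n \<or> Q v)" for Q n
  proof (induction n)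
    case (Suc n)
    define v where "v = (LEAST v. v = n \<or> Q v)"
    have v: "v = n \<or> Q v" unfolding v_def by (rule LeastI[of _ n]) simp
    have below: "\<not> (u = n \<or> Q u)" if "u < v" for u
      using that not_less_Least unfolding v_def by blast
    have "v \<le> n" unfolding v_def by (rule Least_le) simp
    have "(LEAST v. v = Suc n \<or> Q v) = (if v = n \<and> \<not> Q n then Suc n else v)"
    proof (rule Least_equality)
      show "(if v = n \<and> \<not> Q n then Suc n else v) = Suc n \<or> Q (if v = n \<and> \<not> Q n then Suc n else v)"
        using v by auto
      show "(if v = n \<and> \<not> Q n then Suc n else v) \<le> u" if "u = Suc n \<or> Q u" for u
      proof -
        have "v \<le> u" using below[of u] that \<open>v \<le> n\<close> by (cases "u < v") auto
        moreover have "u \<noteq> n" if "\<not> Q n" using \<open>u = Suc n \<or> Q u\<close> that by auto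
        ultimately show ?thesis by auto
      qed
    qed
    with Suc show ?case by (simp add: v_def)
  qed (simp add: Least_equality)
  ultimately show ?thesis by simp
qed

section \<open>Effectiveness of the enlarged tree and of the way back\<close>

definition nth_word_code :: "nat \<Rightarrow> nat \<Rightarrow> nat" where
  "nth_word_code k v = list_encode (map (\<lambda>i. v div 2 ^ (k - Suc i) mod 2) [0..<k])"

text \<open>The right-hand side is the arithmetic form to which the closure rules apply.\<close>

lemma word_code_word: "word_code (word k v) = nth_word_code k v"
proof -
  have "of_bool (odd u) = u mod 2" for u :: nat by (simp add: mod_2_eq_odd)
  then show ?thesis by (simp add: word_code_def word_def nth_word_code_def comp_def)
qed

definition oracle_mem :: "baire \<Rightarrow> nat \<Rightarrow> nat \<Rightarrow> bool" where
  "oracle_mem p k v \<longleftrightarrow> p (nth_word_code k v) = 1"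

lemma oracle_mem_tree: "delta_tree p = Some T \<Longrightarrow> oracle_mem p = (\<lambda>k v. word k v \<in> T)"
  by (intro ext) (simp add: oracle_mem_def delta_tree_mem word_code_word)

lemma effective_nth_word_code [effective_intros]:
  assumes "effective \<nu> a f" "effective \<nu> a g"
  shows "effective \<nu> a (\<lambda>p xs. nth_word_code (f p xs) (g p xs))"
proof (rule effective_comp2[where f = "\<lambda>p. nth_word_code", OF _ assms])
  show "effective \<nu> 2 (\<lambda>p xs. nth_word_code (xs ! 0) (xs ! 1))"
    unfolding nth_word_code_def by (intro effective_intros) auto
qed

lemma effective_oracle_mem [effective_intros]:
  assumes "effective prefix_code a f" "effective prefix_code a g"
  shows "effective prefix_code a (\<lambda>p xs. of_bool (oracle_mem p (f p xs) (g p xs)))"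
  unfolding oracle_mem_def by (intro effective_intros assms)

lemma effective_single [effective_intros]:
  assumes "effective prefix_code a f" "effective prefix_code a g"
  shows "effective prefix_code a (\<lambda>p xs. of_bool (single (oracle_mem p) (f p xs) (g p xs)))"
  unfolding single_def by (intro effective_intros assms)

lemma effective_child [effective_intros]:
  assumes "effective prefix_code a f" "effective prefix_code a g"
  shows "effective prefix_code a (\<lambda>p xs. child (oracle_mem p) (f p xs) (g p xs))"
  unfolding child_def by (intro effective_intros assms)

lemma effective_sibling [effective_intros]:
  assumes "effective prefix_code a f" "effective prefix_code a g"
  shows "effective prefix_code a (\<lambda>p xs. sibling (oracle_mem p) (f p xs) (g p xs))"
  unfolding sibling_def by (intro effective_intros assms)

lemma effective_first_single [effective_intros]:
  assumes "effective prefix_code a f"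
  shows "effective prefix_code a (\<lambda>p xs. first_single (oracle_mem p) (f p xs))"
proof (rule effective_comp1[where f = "\<lambda>p. first_single (oracle_mem p)", OF _ assms])
  show "effective prefix_code 1 (\<lambda>p xs. first_single (oracle_mem p) (xs ! 0))"
    unfolding first_single_def by (intro effective_intros effective_Least) auto
qed

text \<open>The form of the recursion that \<open>effective_rec\<close> covers; \<open>extra\<close>
  is treated in the same way.\<close>

lemma label_rec_nat:
  "label m L i = rec_nat (2 ^ L) (\<lambda>i e. if single m (L + i) e then child m (L + i) e
     else if single m (L + i) (first_single m (L + i)) then child m (L + i) (first_single m (L + i))
     else 2 ^ Suc (L + i)) i"
  by (induction i) (simp_all add: label.simps(2))

lemma effective_label [effective_intros]:
  assumes "effective prefix_code a f"
  shows "effective prefix_code a (\<lambda>p xs. label (oracle_mem p) L (f p xs))"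
proof (rule effective_comp1[where f = "\<lambda>p. label (oracle_mem p) L", OF _ assms])
  show "effective prefix_code 1 (\<lambda>p xs. label (oracle_mem p) L (xs ! 0))"
    unfolding label_rec_nat by (intro effective_intros) auto
qed

lemma extra_rec_nat:
  "extra m L i = rec_nat (LEAST v. v = 2 ^ L \<or> \<not> m L v)
     (\<lambda>i x. if single m (L + i) (label m L i) then 2 * x + label m L (Suc i) mod 2
       else if single m (L + i) (first_single m (L + i)) then sibling m (L + i) (first_single m (L + i))
       else 2 * x) i"
  by (induction i) (simp_all add: extra.simps(2))

lemma effective_extra [effective_intros]:
  assumes "effective prefix_code a f"
  shows "effective prefix_code a (\<lambda>p xs. extra (oracle_mem p) L (f p xs))"
proof (rule effective_comp1[where f = "\<lambda>p. extra (oracle_mem p) L", OF _ assms])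
  show "effective prefix_code 1 (\<lambda>p xs. extra (oracle_mem p) L (xs ! 0))"
    unfolding extra_rec_nat by (intro effective_intros effective_Least) auto
qed

definition extended_name :: "nat \<Rightarrow> baire \<Rightarrow> baire" where
  "extended_name L p m = of_bool (\<exists>k<Suc m. \<exists>v<2 ^ k. m = nth_word_code k v \<and>
     (k < L \<or> p m = 1 \<or> v = extra (oracle_mem p) L (k - L)))"

text \<open>All searches are bounded, so the functional is total, whether or not \<open>p\<close>
  names a tree.\<close>

lemma computable_extended_name: "computable (\<lambda>p. Some (extended_name L p))"
  unfolding extended_name_def by (rule computable_effective, intro effective_intros) auto

lemma extended_name:
  assumes p: "delta_tree p = Some T" and T: "card_m_tree n T" "n \<ge> 1"
    and L: "n < 2 ^ L" "\<And>k. n < 2 ^ k \<Longrightarrow> L \<le> k"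
  shows "extended_name L p = tree_name (extended L T)"
proof
  fix m
  have ext: "word k v \<in> extended L T \<longleftrightarrow> k < L \<or> p (nth_word_code k v) = 1 \<or> v = extra (oracle_mem p) L (k - L)"
    if v: "v < 2 ^ k" for k v
  proof (cases "k < L")
    case False
    have "extra (oracle_mem p) L (k - L) < 2 ^ k"
      using extra_not_mem[OF T L, of "k - L"] False by (simp add: oracle_mem_tree[OF p])
    then show ?thesis using v False delta_tree_mem[OF p, of "word k v"]
      by (simp add: extended_def word_inject word_code_word oracle_mem_tree[OF p])
  qed (simp add: extended_def)
  have "(\<exists>w\<in>extended L T. m = word_code w) \<longleftrightarrow>
      (\<exists>k<Suc m. \<exists>v<2 ^ k. m = nth_word_code k v \<and> (k < L \<or> p m = 1 \<or> v = extra (oracle_mem p) L (k - L)))"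
  proof
    assume "\<exists>w\<in>extended L T. m = word_code w"
    then obtain w where w: "w \<in> extended L T" "m = word_code w" by blast
    obtain v where v: "v < 2 ^ length w" "w = word (length w) v" using word_surj by blast
    have "length w < Suc m" using length_le_word_code[of w] w(2) by simp
    moreover have m: "m = nth_word_code (length w) v" using w(2) v(2) word_code_word by metis
    moreover have "length w < L \<or> p m = 1 \<or> v = extra (oracle_mem p) L (length w - L)"
      using ext[OF v(1)] w(1) v(2) m by metis
    ultimately show "\<exists>k<Suc m. \<exists>v<2 ^ k. m = nth_word_code k v \<and>
        (k < L \<or> p m = 1 \<or> v = extra (oracle_mem p) L (k - L))"
      using v(1) by blast
  next
    assume "\<exists>k<Suc m. \<exists>v<2 ^ k. m = nth_word_code k v \<and> (k < L \<or> p m = 1 \<or> v = extra (oracle_mem p) L (k - L))"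
    then obtain k v where "v < 2 ^ k" "m = nth_word_code k v" "k < L \<or> p m = 1 \<or> v = extra (oracle_mem p) L (k - L)"
      by blast
    then have "word k v \<in> extended L T" "m = word_code (word k v)"
      using ext word_code_word by auto
    then show "\<exists>w\<in>extended L T. m = word_code w" by blast
  qed
  then show "extended_name L p m = tree_name (extended L T) m"
    by (simp only: extended_name_def tree_name_def)
qed

text \<open>In the pairing \<open>s\<close> the even places hold the name of the tree and the odd
  ones the path, so \<open>s (2 * c)\<close> asks whether the word with code \<open>c\<close> is in
  the tree.\<close>

definition flip_exit_name :: "baire \<Rightarrow> baire" where
  "flip_exit_name s i =
     (if s (2 * list_encode (map (\<lambda>j. s (2 * j + 1)) [0..<i])) = 1 \<and>
         s (2 * list_encode (map (\<lambda>j. s (2 * j + 1)) [0..<Suc i])) \<noteq> 1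
      then 1 - s (2 * i + 1) else s (2 * i + 1))"

lemma computable_flip_exit_name: "computable (\<lambda>s. Some (flip_exit_name s))"
  unfolding flip_exit_name_def by (rule computable_effective, intro effective_intros) auto

lemma flip_exit_name:
  assumes p: "delta_tree p = Some T"
  shows "flip_exit_name (pairing p (\<lambda>i. of_bool (y i))) = (\<lambda>i. of_bool (flip_exit T y i))"
proof
  fix i
  let ?s = "pairing p (\<lambda>i. of_bool (y i))"
  have even: "?s (2 * j) = p j" and odd: "?s (2 * j + 1) = of_bool (y j)" for j
    by (simp_all add: pairing_def)
  have mem: "?s (2 * list_encode (map (\<lambda>j. ?s (2 * j + 1)) [0..<k])) = 1 \<longleftrightarrow> map y [0..<k] \<in> T" for k
    unfolding even odd delta_tree_mem[OF p] by (simp add: word_code_def comp_def)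
  show "flip_exit_name ?s i = of_bool (flip_exit T y i)"
    unfolding flip_exit_name_def mem unfolding flip_exit_def odd by (simp del: upt_Suc)
qed

theorem C_card_le_Suc:
  assumes n: "n \<ge> 1"
  shows "weihrauch_le delta_tree delta_cantor (C_card n) delta_tree delta_cantor (C_card (Suc n))"
proof -
  define L where "L = (LEAST k. n < 2 ^ k)"
  have L: "n < 2 ^ L" "\<And>k. n < 2 ^ k \<Longrightarrow> L \<le> k"
    unfolding L_def using LeastI[of "\<lambda>k. n < 2 ^ k" n] Least_le[of "\<lambda>k. n < 2 ^ k"]
    by simp_all
  \<comment> \<open>The reduction enlarges the tree by \<open>extended_name\<close> and repairs the
    answer by \<open>flip_exit_name\<close>.\<close>
  have "\<exists>q y. (case Some (extended_name L p) of None \<Rightarrow> None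
        | Some r \<Rightarrow> (case G r of None \<Rightarrow> None | Some s \<Rightarrow> Some (flip_exit_name (pairing p s)))) = Some q \<and>
      delta_cantor q = Some y \<and> y \<in> C_card n T"
    if G: "realizes delta_tree delta_cantor (C_card (Suc n)) G"
      and p: "delta_tree p = Some T" "C_card n T \<noteq> {}" for G p T
  proof -
    have T: "card_m_tree n T" using p(2) n by (simp add: C_card_nonempty_iff)
    have E: "card_m_tree (Suc n) (extended L T)" by (rule card_m_tree_extended[OF T n L])
    have "delta_tree (extended_name L p) = Some (extended L T)"
      using extended_name[OF p(1) T n L] E by (simp add: delta_tree_name card_m_tree_def)
    moreover have "C_card (Suc n) (extended L T) \<noteq> {}" using E by (simp add: C_card_nonempty_iff)
    ultimately obtain s y where s: "G (extended_name L p) = Some s" "delta_cantor s = Some y"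
      "y \<in> C_card (Suc n) (extended L T)"
      using G unfolding realizes_def by blast
    have y: "y \<in> paths (extended L T)" using s(3) E by (simp add: C_card_def)
    have "s = (\<lambda>i. of_bool (y i))" by (intro ext delta_cantor_value[OF s(2)])
    then have "flip_exit_name (pairing p s) = (\<lambda>i. of_bool (flip_exit T y i))"
      using flip_exit_name[OF p(1)] by simp
    moreover have "flip_exit T y \<in> C_card n T"
      using flip_exit_path[OF T n L y] T by (simp add: C_card_def)
    ultimately show ?thesis using s(1) by (simp add: delta_cantor_of_bool)
  qed
  then show ?thesis
    unfolding weihrauch_le_def realizes_def[of _ _ "C_card n"]
    by (intro exI[of _ "\<lambda>s. Some (flip_exit_name s)"] exI[of _ "\<lambda>p. Some (extended_name L p)"]
        conjI computable_flip_exit_name computable_extended_name allI impI) blast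
qed

theorem theorem37:
  fixes n :: nat
  assumes "n \<ge> 1"
  shows "weihrauch_le delta_tree delta_cantor (C_card n) delta_tree delta_cantor (C_card (n + 1))
       \<and> \<not> weihrauch_le delta_tree delta_cantor (C_card (n + 1)) delta_tree delta_cantor (C_card n)"
  using C_card_le_Suc[OF assms] C_card_Suc_not_le[OF assms] by simp

end
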